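(* Let $\mathbf{k}$ be a field, $d$ a positive integer, and let $M$ be a finitely generated module over the twisted commutative algebra $\mathbf{k}\langle x_1,\dots,x_d\rangle$. Then $\mathrm{H}'_M(t)=\sum_{n\ge0}\dim_{\mathbf{k}}(M_n)\frac{t^n}{n!}$ belongs to $\mathbf{Q}[t,e^t]$.
   Context: $A=\mathbf{k}\langle x_1,\dots,x_d\rangle$ is the polynomial twisted commutative algebra: as a graded $\mathbf{k}$-algebra it is the non-commutative polynomial ring in $x_1,\dots,x_d$ (each of degree $1$), with $S_n$ acting on the degree $n$ piece $A_n$ by permuting the positions of the letters of monomials: $\sigma\cdot(x_{i_1}\cdots x_{i_n})=x_{i_{\sigma^{-1}(1)}}\cdots x_{i_{\sigma^{-1}(n)}}$. An $A$-module is a graded (left) $A$-module $M=\bigoplus_{n\ge0}M_n$ equipped with an action of the symmetric group $S_n$ on $M_n$ such that each multiplication map $A_n\otimes M_m\to M_{n+m}$ is $(S_n\times S_m)$-equivariant, where $S_n\times S_m\subset S_{n+m}$ is the standard embedding. It is finitely generated if there are finitely many homogeneous elements such that $M$ is the smallest graded $A$-submodule stable under all symmetric group actions containing them. *)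

theory Defs
  imports
    "HOL-Library.Poly_Mapping"
    "HOL-Combinatorics.Permutations"
    "HOL-Computational_Algebra.Polynomial_FPS"
begin

text \<open>
  The free monoid on \<^typ>\<open>'d\<close>, written additively so that the convolution product of
  \<^type>\<open>poly_mapping\<close> is the product of the free algebra. Its elements are the monomials in the
  non-commuting variables indexed by \<^typ>\<open>'d\<close>.
\<close>

datatype 'd word = Word (letters: "'d list")

instantiation word :: (type) monoid_add
begin

definition zero_word :: "'a word" where
  "0 = Word []"

definition plus_word :: "'a word \<Rightarrow> 'a word \<Rightarrow> 'a word" where
  "u + v = Word (letters u @ letters v)"

instance
  by standard (simp_all add: zero_word_def plus_word_def)

end

text \<open>
  For \<^typ>\<open>'d\<close> finite with $d$ elements this is $\mathbf{k}\langle x_1,\dots,x_d\rangle$; the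
  ring structure is the library instance for \<^type>\<open>poly_mapping\<close>.
\<close>

type_synonym ('d, 'k) tca = "'d word \<Rightarrow>\<^sub>0 'k"

definition tca_const :: "'k \<Rightarrow> ('d, 'k::field) tca" where
  "tca_const c = Poly_Mapping.single 0 c"

definition tca_piece :: "nat \<Rightarrow> ('d, 'k::field) tca set" where
  "tca_piece n = {a. \<forall>w \<in> Poly_Mapping.keys a. length (letters w) = n}"

text \<open>
  Permutations act on positions \<open>0, \<dots>, n - 1\<close>. The inverse makes this a left action: position
  \<open>i\<close> of \<open>\<sigma> \<cdot> w\<close> carries the letter of \<open>w\<close> at position \<open>inv \<sigma> i\<close>.
\<close>

definition word_perm :: "(nat \<Rightarrow> nat) \<Rightarrow> 'd word \<Rightarrow> 'd word" where
  "word_perm \<sigma> w = Word (permute_list (inv \<sigma>) (letters w))"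

definition tca_perm :: "(nat \<Rightarrow> nat) \<Rightarrow> ('d, 'k::field) tca \<Rightarrow> ('d, 'k) tca" where
  "tca_perm \<sigma> a =
     (\<Sum>w \<in> Poly_Mapping.keys a.
        Poly_Mapping.single (word_perm \<sigma> w) (Poly_Mapping.lookup a w))"

text \<open>
  The standard embedding $S_n \times S_m \subset S_{n+m}$: \<open>\<sigma>\<close> acts on the first \<open>n\<close> positions
  and \<open>\<tau>\<close> on the last \<open>m\<close>.
\<close>

definition perm_sum :: "nat \<Rightarrow> (nat \<Rightarrow> nat) \<Rightarrow> (nat \<Rightarrow> nat) \<Rightarrow> nat \<Rightarrow> nat" where
  "perm_sum n \<sigma> \<tau> i = (if i < n then \<sigma> i else n + \<tau> (i - n))"


text \<open>
  \<open>f\<close> lists the homogeneous components of an element of \<open>\<Oplus>\<^sub>n M n\<close>.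
\<close>

definition graded_family :: "(nat \<Rightarrow> 'm::ab_group_add set) \<Rightarrow> (nat \<Rightarrow> 'm) \<Rightarrow> bool" where
  "graded_family M f \<longleftrightarrow> (\<forall>n. f n \<in> M n) \<and> finite {n. f n \<noteq> 0}"

definition family_sum :: "(nat \<Rightarrow> 'm::ab_group_add) \<Rightarrow> 'm" where
  "family_sum f = (\<Sum>n | f n \<noteq> 0. f n)"

text \<open>
  The whole type \<^typ>\<open>'m\<close> is the module, and \<open>M n\<close> is its piece of degree \<open>n\<close>.
  The map \<open>perm n \<sigma>\<close> is only relevant on \<open>M n\<close> and for \<open>\<sigma>\<close> a permutation of \<open>{..<n}\<close>.
\<close>

locale tca_module =
  fixes amult :: "('d, 'k::field) tca \<Rightarrow> 'm::ab_group_add \<Rightarrow> 'm"  (infixr \<open>\<odot>\<close> 75)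
    and M :: "nat \<Rightarrow> 'm set"
    and perm :: "nat \<Rightarrow> (nat \<Rightarrow> nat) \<Rightarrow> 'm \<Rightarrow> 'm"
  assumes amult_add_right: "a \<odot> (x + y) = a \<odot> x + a \<odot> y"
    and amult_add_left: "(a + b) \<odot> x = a \<odot> x + b \<odot> x"
    and amult_assoc: "a \<odot> b \<odot> x = (a * b) \<odot> x"
    and amult_one: "1 \<odot> x = x"
    and piece_zero: "0 \<in> M n"
    and piece_add: "x \<in> M n \<Longrightarrow> y \<in> M n \<Longrightarrow> x + y \<in> M n"
    and piece_amult: "a \<in> tca_piece n \<Longrightarrow> x \<in> M m \<Longrightarrow> a \<odot> x \<in> M (n + m)"
    and direct_sum: "\<exists>!f. graded_family M f \<and> family_sum f = x"
    and perm_closed: "\<sigma> permutes {..<n} \<Longrightarrow> x \<in> M n \<Longrightarrow> perm n \<sigma> x \<in> M n"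
    and perm_add: "\<sigma> permutes {..<n} \<Longrightarrow> x \<in> M n \<Longrightarrow> y \<in> M n \<Longrightarrow>
          perm n \<sigma> (x + y) = perm n \<sigma> x + perm n \<sigma> y"
    and perm_scale: "\<sigma> permutes {..<n} \<Longrightarrow> x \<in> M n \<Longrightarrow>
          perm n \<sigma> (tca_const c \<odot> x) = tca_const c \<odot> perm n \<sigma> x"
    and perm_id: "x \<in> M n \<Longrightarrow> perm n id x = x"
    and perm_comp: "\<sigma> permutes {..<n} \<Longrightarrow> \<tau> permutes {..<n} \<Longrightarrow> x \<in> M n \<Longrightarrow>
          perm n (\<sigma> \<circ> \<tau>) x = perm n \<sigma> (perm n \<tau> x)"
    and equivariant: "\<sigma> permutes {..<n} \<Longrightarrow> \<tau> permutes {..<m} \<Longrightarrow>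
          a \<in> tca_piece n \<Longrightarrow> x \<in> M m \<Longrightarrow>
          perm (n + m) (perm_sum n \<sigma> \<tau>) (a \<odot> x) = tca_perm \<sigma> a \<odot> perm m \<tau> x"
begin

definition kscale :: "'k \<Rightarrow> 'm \<Rightarrow> 'm" where
  "kscale c x = tca_const c \<odot> x"

sublocale k: vector_space kscale
proof
  show "kscale (a + b) x = kscale a x + kscale b x" for a b x
    by (simp add: kscale_def tca_const_def single_add amult_add_left)
  show "kscale a (kscale b x) = kscale (a * b) x" for a b x
    by (simp add: kscale_def tca_const_def amult_assoc mult_single)
  show "kscale 1 x = x" for x
    using amult_one by (simp add: kscale_def tca_const_def)
qed (simp add: kscale_def amult_add_right)

definition graded_submodule :: "'m set \<Rightarrow> bool" where
  "graded_submodule N \<longleftrightarrow>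
     0 \<in> N \<and> (\<forall>x \<in> N. \<forall>y \<in> N. x + y \<in> N) \<and> (\<forall>a. \<forall>x \<in> N. a \<odot> x \<in> N) \<and>
     (\<forall>f. graded_family M f \<longrightarrow> family_sum f \<in> N \<longrightarrow> (\<forall>n. f n \<in> N))"

definition perm_stable :: "'m set \<Rightarrow> bool" where
  "perm_stable N \<longleftrightarrow> (\<forall>n \<sigma>. \<sigma> permutes {..<n} \<longrightarrow> (\<forall>x \<in> N \<inter> M n. perm n \<sigma> x \<in> N))"

definition finitely_generated :: bool where
  "finitely_generated \<longleftrightarrow>
     (\<exists>G. finite G \<and> G \<subseteq> (\<Union>n. M n) \<and>
          \<Inter>{N. graded_submodule N \<and> perm_stable N \<and> G \<subseteq> N} = UNIV)"

text \<open>
  The dimension function of the library is \<open>0\<close> on infinite-dimensional spaces; the pieces of a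
  finitely generated module are finite-dimensional when \<^typ>\<open>'d\<close> is finite.
\<close>

definition exp_hilbert_series :: "rat fps" where
  "exp_hilbert_series = Abs_fps (\<lambda>n. of_nat (k.dim (M n)) / fact n)"

end

text \<open>
  The image of $\mathbf{Q}[X][Y]$ in $\mathbf{Q}[[t]]$ under $X \mapsto t$, $Y \mapsto e^t$.
\<close>

definition poly_t_exp_t :: "rat fps set" where
  "poly_t_exp_t = range (\<lambda>P :: rat poly poly. poly (map_poly fps_of_poly P) (fps_exp 1))"

end

theory Submission
  imports
    Defs
    "HOL-Library.Countable"
    "HOL-Library.List_Lexorder"
    "HOL-Library.Multiset_Order"
    "HOL-Library.Product_Lexorder"
    "HOL-Library.Sublist"
begin

text \<open>
  A generator \<open>g\<close> of degree \<open>m\<close> contributes to \<open>M\<^sub>n\<close> the vectors obtained by choosing a word of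
  length \<open>n\<close> whose entries are variables and the stars \<open>0, \<dots>, m - 1\<close>, each used once: the stars
  are the positions of \<open>g\<close>. Inserting a variable at a fixed position is a linear map
  \<open>M\<^sub>n \<rightarrow> M\<^sub>n\<^sub>+\<^sub>1\<close> that preserves the lexicographic order of words. Hence, among all these
  vectors, those not in the span of the smaller ones form a basis of \<open>M\<^sub>n\<close> indexed by a set of
  words closed under deleting variables. For a fixed order of the stars such a word is a tuple of
  \<open>m + 1\<close> words in the variables, so it remains to count sets of tuples closed under taking
  subwords. This is a recursion on alphabet sizes that only involves the operations sum, difference
  and \<open>h(n + 1) = j h(n) + f(n)\<close> on sequences; on exponential generating functions the latter is
  the equation \<open>H' = j H + F\<close>, which is solvable in $\mathbf{Q}[t, e^t]$ for a natural number \<open>j\<close>.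
\<close>

section \<open>Power series in $t$ and $e^t$\<close>

lemma pCons_poly_t_exp_t:
  "poly (map_poly fps_of_poly (pCons p P)) (fps_exp 1) =
    fps_of_poly p + fps_exp 1 * poly (map_poly fps_of_poly P) (fps_exp (1::rat))"
  by (simp add: map_poly_pCons)

lemma poly_t_exp_t_step:
  "F \<in> poly_t_exp_t \<Longrightarrow> fps_of_poly p + fps_exp 1 * F \<in> poly_t_exp_t"
  unfolding poly_t_exp_t_def by (metis (no_types, lifting) pCons_poly_t_exp_t image_iff rangeI)

lemma poly_t_exp_t_zero: "0 \<in> poly_t_exp_t"
  unfolding poly_t_exp_t_def by (rule range_eqI[where x = 0]) simp

text \<open>Horner's scheme in e^t: peeling off the constant coefficient of a polynomial over Q[t]
  leaves an element of the same set, so closure properties can be proved on power series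
  directly.\<close>

lemma poly_t_exp_t_induct [consumes 1, case_names zero step]:
  assumes "F \<in> poly_t_exp_t" "Q 0"
    and "\<And>p F. F \<in> poly_t_exp_t \<Longrightarrow> Q F \<Longrightarrow> Q (fps_of_poly p + fps_exp 1 * F)"
  shows "Q F"
proof -
  have "Q (poly (map_poly fps_of_poly P) (fps_exp 1))" for P
  proof (induction P)
    case 0
    show ?case using assms(2) by simp
  next
    case (pCons p P)
    show ?case
      unfolding pCons_poly_t_exp_t by (rule assms(3)[OF _ pCons.IH]) (auto simp: poly_t_exp_t_def)
  qed
  then show ?thesis using assms(1) by (auto simp: poly_t_exp_t_def)
qed

lemma poly_t_exp_t_poly: "fps_of_poly p \<in> poly_t_exp_t"
  using poly_t_exp_t_step[OF poly_t_exp_t_zero, of p] by simp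

lemma poly_t_exp_t_exp: "F \<in> poly_t_exp_t \<Longrightarrow> fps_exp 1 * F \<in> poly_t_exp_t"
  using poly_t_exp_t_step[of F 0] by simp

lemma poly_t_exp_t_add: "F \<in> poly_t_exp_t \<Longrightarrow> F' \<in> poly_t_exp_t \<Longrightarrow> F + F' \<in> poly_t_exp_t"
proof (induction F arbitrary: F' rule: poly_t_exp_t_induct)
  case zero
  then show ?case by simp
next
  case (step p F)
  show ?case using step.prems
  proof (induction F' rule: poly_t_exp_t_induct)
    case zero
    show ?case using poly_t_exp_t_step[OF step.hyps] by simp
  next
    case (step q F')
    \<comment> \<open>The tails of the two Horner schemes are added by the outer induction
      hypothesis, the constant coefficients directly.\<close>
    then show ?case
      using poly_t_exp_t_step[OF \<open>\<And>F'. F' \<in> poly_t_exp_t \<Longrightarrow> F + F' \<in> poly_t_exp_t\<close>[OF step.hyps], of "p + q"]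
      by (simp add: fps_of_poly_add algebra_simps)
  qed
qed

lemma poly_t_exp_t_poly_mult:
  "F \<in> poly_t_exp_t \<Longrightarrow> fps_of_poly q * F \<in> poly_t_exp_t"
proof (induction F rule: poly_t_exp_t_induct)
  case zero
  then show ?case by (simp add: poly_t_exp_t_zero)
next
  case (step p F)
  have "fps_of_poly (q * p) + fps_exp 1 * (fps_of_poly q * F) \<in> poly_t_exp_t"
    by (rule poly_t_exp_t_step[OF step.IH])
  then show ?case by (simp add: fps_of_poly_mult algebra_simps)
qed

lemma poly_t_exp_t_const_mult: "F \<in> poly_t_exp_t \<Longrightarrow> fps_const c * F \<in> poly_t_exp_t"
  using poly_t_exp_t_poly_mult[of F "[:c:]"] by (simp add: fps_of_poly_const)

lemma poly_t_exp_t_deriv: "F \<in> poly_t_exp_t \<Longrightarrow> fps_deriv F \<in> poly_t_exp_t"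
proof (induction F rule: poly_t_exp_t_induct)
  case zero
  then show ?case by (simp add: poly_t_exp_t_zero)
next
  case (step p F)
  have "fps_of_poly (pderiv p) + fps_exp 1 * (F + fps_deriv F) \<in> poly_t_exp_t"
    by (intro poly_t_exp_t_step poly_t_exp_t_add step)
  then show ?case by (simp add: fps_of_poly_pderiv algebra_simps)
qed

lemma poly_t_exp_t_exp_nat: "fps_exp (of_nat j) \<in> poly_t_exp_t"
proof (induction j)
  case 0
  show ?case using poly_t_exp_t_poly[of 1] by simp
next
  case (Suc j)
  then show ?case using poly_t_exp_t_exp[OF Suc] by (simp add: fps_exp_add_mult)
qed

lemma sum_pderiv: "pderiv (\<Sum>i\<in>I. f i) = (\<Sum>i\<in>I. pderiv (f i))"
  by (induction I rule: infinite_finite_induct) (simp_all add: pderiv_add)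

lemma pderiv_surj: "\<exists>q. pderiv q = (p :: 'a :: field_char_0 poly)"
proof
  have "pderiv (\<Sum>i\<le>degree p. monom (coeff p i / of_nat (Suc i)) (Suc i)) =
      (\<Sum>i\<le>degree p. monom (coeff p i) i)"
    unfolding sum_pderiv
  proof (rule sum.cong[OF refl])
    fix i
    have "(of_nat (Suc i) :: 'a) \<noteq> 0" using of_nat_neq_0 by blast
    then show "pderiv (monom (coeff p i / of_nat (Suc i)) (Suc i)) = monom (coeff p i) i"
      by (simp add: pderiv_monom del: of_nat_Suc)
  qed
  then show "pderiv (\<Sum>i\<le>degree p. monom (coeff p i / of_nat (Suc i)) (Suc i)) = p"
    by (simp add: poly_as_sum_of_monoms)
qed

text \<open>For nonzero mu: if r solves the equation with p' in place of p, then q = (r - p) / mu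
  satisfies q' = r = mu q + p. Differentiating lowers the degree until a constant remains. For mu =
  0 this is integration.\<close>

lemma ode_poly:
  fixes p :: "'a :: field_char_0 poly"
  shows "\<exists>q. pderiv q = smult \<mu> q + p"
proof (cases "\<mu> = 0")
  case True
  then show ?thesis using pderiv_surj[of p] by simp
next
  case False
  show ?thesis
  proof (induction "degree p" arbitrary: p rule: less_induct)
    case less
    show ?case
    proof (cases "degree p = 0")
      case True
      then obtain c where "p = [:c:]" using degree_eq_zeroE by blast
      then show ?thesis using False by (intro exI[of _ "[:- c / \<mu>:]"]) (simp add: pderiv_pCons)
    next
      case deg: False
      then have "degree (pderiv p) < degree p" by (simp add: degree_pderiv)
      then obtain r where "pderiv r = smult \<mu> r + pderiv p" using less by blast
      then have "pderiv (smult (1 / \<mu>) (r - p)) = smult \<mu> (smult (1 / \<mu>) (r - p)) + p"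
        using False by (simp add: pderiv_smult pderiv_diff smult_add_right smult_diff_right)
      then show ?thesis by blast
    qed
  qed
qed

text \<open>With the ansatz q + e^t K the equation decouples into q' = mu q + p and K' = (mu - 1) K
  + F. Hence mu varies in the induction, and the value 0 can occur on the way.\<close>

lemma ode_poly_t_exp_t:
  "F \<in> poly_t_exp_t \<Longrightarrow> \<exists>K \<in> poly_t_exp_t. fps_deriv K = fps_const \<mu> * K + F"
proof (induction F arbitrary: \<mu> rule: poly_t_exp_t_induct)
  case zero
  show ?case by (rule bexI[OF _ poly_t_exp_t_zero]) simp
next
  case (step p F)
  obtain q where q: "pderiv q = smult \<mu> q + p" using ode_poly by blast
  obtain K where K: "K \<in> poly_t_exp_t" "fps_deriv K = fps_const (\<mu> - 1) * K + F"
    using step.IH by blast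
  have \<mu>: "fps_const \<mu> = 1 + fps_const (\<mu> - 1)"
    by (simp flip: fps_const_1_eq_1 add: fps_const_add)
  have "fps_deriv (fps_of_poly q + fps_exp 1 * K) =
      fps_const \<mu> * (fps_of_poly q + fps_exp 1 * K) + (fps_of_poly p + fps_exp 1 * F)"
    unfolding \<mu> using K(2)
    by (simp add: q fps_of_poly_add fps_of_poly_smult \<mu> algebra_simps flip: fps_of_poly_pderiv)
  then show ?case using poly_t_exp_t_step[OF K(1)] by blast
qed

section \<open>Sequences with exponential generating function in Q[t, e^t]\<close>

definition egf_poly_exp :: "(nat \<Rightarrow> rat) \<Rightarrow> bool" where
  "egf_poly_exp f \<longleftrightarrow> Abs_fps (\<lambda>n. f n / fact n) \<in> poly_t_exp_t"

lemma egf_poly_exp_zero: "egf_poly_exp (\<lambda>_. 0)"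
proof -
  have "Abs_fps (\<lambda>n. 0 / fact n) = (0 :: rat fps)" by (simp add: fps_eq_iff)
  then show ?thesis unfolding egf_poly_exp_def using poly_t_exp_t_zero by simp
qed

lemma egf_poly_exp_add:
  assumes "egf_poly_exp f" "egf_poly_exp g"
  shows "egf_poly_exp (\<lambda>n. f n + g n)"
proof -
  have "Abs_fps (\<lambda>n. (f n + g n) / fact n) =
      Abs_fps (\<lambda>n. f n / fact n) + Abs_fps (\<lambda>n. g n / fact n)"
    by (simp add: fps_eq_iff add_divide_distrib)
  then show ?thesis using assms poly_t_exp_t_add unfolding egf_poly_exp_def by simp
qed

lemma egf_poly_exp_cmult:
  assumes "egf_poly_exp f"
  shows "egf_poly_exp (\<lambda>n. c * f n)"
proof -
  have "Abs_fps (\<lambda>n. (c * f n) / fact n) = fps_const c * Abs_fps (\<lambda>n. f n / fact n)"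
    by (simp add: fps_eq_iff)
  then show ?thesis using assms poly_t_exp_t_const_mult unfolding egf_poly_exp_def by simp
qed

lemma egf_poly_exp_diff:
  assumes "egf_poly_exp f" "egf_poly_exp g"
  shows "egf_poly_exp (\<lambda>n. f n - g n)"
  using egf_poly_exp_add[OF assms(1) egf_poly_exp_cmult[OF assms(2), of "-1"]] by simp

lemma egf_poly_exp_sum:
  assumes "\<And>i. i \<in> I \<Longrightarrow> egf_poly_exp (f i)"
  shows "egf_poly_exp (\<lambda>n. \<Sum>i\<in>I. f i n)"
  using assms by (induction I rule: infinite_finite_induct)
    (auto intro: egf_poly_exp_add egf_poly_exp_zero)

lemma egf_poly_exp_Suc:
  assumes "egf_poly_exp f"
  shows "egf_poly_exp (\<lambda>n. f (Suc n))"
proof -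
  have "Abs_fps (\<lambda>n. f (Suc n) / fact n) = fps_deriv (Abs_fps (\<lambda>n. f n / fact n))"
    by (simp add: fps_eq_iff fact_Suc)
  then show ?thesis using assms poly_t_exp_t_deriv unfolding egf_poly_exp_def by simp
qed

text \<open>The generating functions satisfy H' = j H + F. Two solutions differ by a multiple of
  e^(j t), which lies in Q[t, e^t] because j is a natural number.\<close>

lemma egf_poly_exp_recurrence:
  assumes f: "egf_poly_exp f" and h: "\<And>n. h (Suc n) = of_nat j * h n + f n"
  shows "egf_poly_exp h"
proof -
  define F where "F = Abs_fps (\<lambda>n. f n / fact n)"
  obtain K0 where K0: "K0 \<in> poly_t_exp_t" "fps_deriv K0 = fps_const (of_nat j) * K0 + F"
    using ode_poly_t_exp_t f unfolding F_def egf_poly_exp_def by blast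
  \<comment> \<open>The multiple of e^(j t) corrects the constant term to \<open>h 0\<close>; the
    differential equation then determines all further coefficients.\<close>
  define K where "K = K0 + fps_const (h 0 - fps_nth K0 0) * fps_exp (of_nat j)"
  have K: "K \<in> poly_t_exp_t"
    unfolding K_def
    by (intro poly_t_exp_t_add K0(1) poly_t_exp_t_const_mult poly_t_exp_t_exp_nat)
  have dK: "fps_deriv K = fps_const (of_nat j) * K + F"
    unfolding K_def by (simp add: K0(2) algebra_simps)
  have "fps_nth K n = h n / fact n" for n
  proof (induction n)
    case 0
    then show ?case by (simp add: K_def)
  next
    case (Suc n)
    have "of_nat (Suc n) * fps_nth K (Suc n) = of_nat j * fps_nth K n + f n / fact n"
      using arg_cong[OF dK, of "\<lambda>G. fps_nth G n"] by (simp add: F_def)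
    then have "of_nat (Suc n) * fps_nth K (Suc n) = h (Suc n) / fact n"
      by (simp add: Suc h add_divide_distrib)
    moreover have "(of_nat (Suc n) :: rat) \<noteq> 0" using of_nat_neq_0 by blast
    ultimately show ?case by (simp add: field_simps del: of_nat_Suc)
  qed
  then have "Abs_fps (\<lambda>n. h n / fact n) = K" by (simp add: fps_eq_iff)
  then show ?thesis using K by (simp add: egf_poly_exp_def)
qed

text \<open>Each prepended zero is one integration, that is, the recurrence with j = 0 and initial
  value 0.\<close>

lemma egf_poly_exp_shift:
  assumes "egf_poly_exp f"
  shows "egf_poly_exp (\<lambda>n. if n < m then 0 else f (n - m))"
proof (induction m)
  case 0
  then show ?case using assms by simp
next
  case (Suc m)
  show ?case by (rule egf_poly_exp_recurrence[OF Suc, where j = 0]) auto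
qed

section \<open>Subword-closed sets of tuples of words\<close>

definition tuples :: "'a set list \<Rightarrow> 'a list list set" where
  "tuples As = {us. list_all2 (\<lambda>A u. set u \<subseteq> A) As us}"

definition downclosed :: "'a list list set \<Rightarrow> bool" where
  "downclosed D \<longleftrightarrow> (\<forall>us \<in> D. \<forall>vs. list_all2 subseq vs us \<longrightarrow> vs \<in> D)"

definition total_length :: "'a list list \<Rightarrow> nat" where
  "total_length us = sum_list (map length us)"

definition tuple_count :: "'a list list set \<Rightarrow> nat \<Rightarrow> rat" where
  "tuple_count D n = of_nat (card {us \<in> D. total_length us = n})"

lemma egf_poly_exp_empty: "egf_poly_exp (tuple_count {})"
  using egf_poly_exp_zero unfolding tuple_count_def by simp

lemma total_length_simps [simp]:
  "total_length [] = 0"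
  "total_length (u # us) = length u + total_length us"
  "total_length (us @ vs) = total_length us + total_length vs"
  by (simp_all add: total_length_def)

lemma tuples_length: "us \<in> tuples As \<Longrightarrow> length us = length As"
  unfolding tuples_def by (auto dest: list_all2_lengthD)

lemma finite_tuples:
  assumes "\<forall>A \<in> set As. finite A"
  shows "finite {us \<in> tuples As. total_length us = n}"
proof -
  let ?U = "\<Union>(set As)"
  have "{us \<in> tuples As. total_length us = n} \<subseteq>
      {us. set us \<subseteq> {u. set u \<subseteq> ?U \<and> length u \<le> n} \<and> length us = length As}"
  proof safe
    fix us u assume us: "us \<in> tuples As" and u: "u \<in> set us" and n: "n = total_length us"
    obtain i where i: "i < length us" "u = us ! i" using u by (metis in_set_conv_nth)
    then have "set u \<subseteq> As ! i"
      using us by (simp add: tuples_def list_all2_conv_all_nth)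
    moreover have "As ! i \<in> set As" using i tuples_length[OF us] by simp
    ultimately show "x \<in> ?U" if "x \<in> set u" for x using that by blast
    show "length u \<le> total_length us"
      unfolding total_length_def using u by (intro member_le_sum_list) auto
  qed (rule tuples_length)
  moreover have "finite {u. set u \<subseteq> ?U \<and> length u \<le> n}"
    using assms by (intro finite_lists_length_le) auto
  ultimately show ?thesis
    using finite_lists_length_eq finite_subset by blast
qed

lemma finite_tuples_subset:
  assumes "\<forall>A \<in> set As. finite A" "D \<subseteq> tuples As"
  shows "finite {us \<in> D. total_length us = n}"
  by (rule finite_subset[OF _ finite_tuples[OF assms(1), of n]]) (use assms(2) in auto)

lemma tuple_count_Un:
  assumes "\<forall>A \<in> set As. finite A" "D \<subseteq> tuples As" "D' \<subseteq> tuples As"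
  shows "tuple_count (D \<union> D') n = tuple_count D n + tuple_count D' n - tuple_count (D \<inter> D') n"
proof -
  let ?f = "\<lambda>D. {us \<in> D. total_length us = n}"
  have "card (?f D) + card (?f D') = card (?f D \<union> ?f D') + card (?f D \<inter> ?f D')"
    by (rule card_Un_Int) (use assms in \<open>auto intro: finite_tuples_subset\<close>)
  moreover have "?f D \<union> ?f D' = ?f (D \<union> D')" "?f D \<inter> ?f D' = ?f (D \<inter> D')" by auto
  ultimately have "card (?f D) + card (?f D') = card (?f (D \<union> D')) + card (?f (D \<inter> D'))"
    by simp
  then have "(of_nat (card (?f D) + card (?f D')) :: rat) =
      of_nat (card (?f (D \<union> D')) + card (?f (D \<inter> D')))" by (rule arg_cong)
  then show ?thesis
    unfolding tuple_count_def of_nat_add by linarith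
qed

lemma downclosed_Int: "downclosed D \<Longrightarrow> downclosed D' \<Longrightarrow> downclosed (D \<inter> D')"
  by (auto simp: downclosed_def)

lemma tuple_count_tuples:
  assumes "\<forall>A \<in> set As. finite A"
  shows "egf_poly_exp (tuple_count (tuples As))"
  using assms
proof (induction As)
  case Nil
  have "{us \<in> tuples ([] :: 'a set list). total_length us = n} = (if n = 0 then {[]} else {})" for n
    by (auto simp: tuples_def)
  then have "tuple_count (tuples ([] :: 'a set list)) = (\<lambda>n. if n = 0 then 1 else 0)"
    by (auto simp: tuple_count_def)
  \<comment> \<open>The recurrence with j = 0 and f = 0 leaves the value at 0 free.\<close>
  moreover have "egf_poly_exp (\<lambda>n. if n = 0 then 1 else 0)"
    by (rule egf_poly_exp_recurrence[OF egf_poly_exp_zero, where j = 0]) simp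
  ultimately show ?case by simp
next
  case (Cons A As)
  let ?T = "\<lambda>Bs n. {us \<in> tuples Bs. total_length us = n}"
  have rec: "tuple_count (tuples (A # As)) (Suc n) =
      of_nat (card A) * tuple_count (tuples (A # As)) n + tuple_count (tuples As) (Suc n)" for n
  proof -
    have eq: "?T (A # As) (Suc n) =
        (\<lambda>(a, us). (a # hd us) # tl us) ` (A \<times> ?T (A # As) n) \<union> (#) [] ` ?T As (Suc n)"
    proof (intro equalityI subsetI)
      fix us assume us: "us \<in> ?T (A # As) (Suc n)"
      then obtain v vs where v: "us = v # vs" "set v \<subseteq> A" "vs \<in> tuples As"
        by (auto simp: tuples_def list_all2_Cons1)
      show "us \<in> (\<lambda>(a, us). (a # hd us) # tl us) ` (A \<times> ?T (A # As) n) \<union> (#) [] ` ?T As (Suc n)"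
      proof (cases v)
        case Nil
        then have "us = [] # vs" "vs \<in> ?T As (Suc n)" using us v by auto
        then show ?thesis by blast
      next
        case (Cons a v')
        then have "us = (\<lambda>(a, us). (a # hd us) # tl us) (a, v' # vs)" "(a, v' # vs) \<in> A \<times> ?T (A # As) n"
          using us v by (auto simp: tuples_def)
        then show ?thesis by blast
      qed
    qed (auto simp: tuples_def list_all2_Cons1)
    have "card (?T (A # As) (Suc n)) =
        card ((\<lambda>(a, us). (a # hd us) # tl us) ` (A \<times> ?T (A # As) n)) + card ((#) [] ` ?T As (Suc n))"
      unfolding eq
    proof (rule card_Un_disjoint)
      have "finite A" using Cons.prems by simp
      then show "finite ((\<lambda>(a, us). (a # hd us) # tl us) ` (A \<times> ?T (A # As) n))"
        by (intro finite_imageI finite_cartesian_product finite_tuples[OF Cons.prems])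
      show "finite ((#) [] ` ?T As (Suc n))" using Cons.prems by (intro finite_imageI finite_tuples) simp
    qed auto
    also have "card ((\<lambda>(a, us). (a # hd us) # tl us) ` (A \<times> ?T (A # As) n)) =
        card A * card (?T (A # As) n)"
    proof -
      have "inj_on (\<lambda>(a, us). (a # hd us) # tl us) (A \<times> ?T (A # As) n)"
      proof (rule inj_onI)
        fix p q assume "p \<in> A \<times> ?T (A # As) n" "q \<in> A \<times> ?T (A # As) n"
          and eq: "(case p of (a, us) \<Rightarrow> (a # hd us) # tl us) = (case q of (a, us) \<Rightarrow> (a # hd us) # tl us)"
        moreover have "\<exists>a u us. p = (a, u # us)" if "p \<in> A \<times> ?T (A # As) n" for p
          using that unfolding tuples_def by (cases p) (auto simp: list_all2_Cons1)
        ultimately obtain a u us b v vs where "p = (a, u # us)" "q = (b, v # vs)" by meson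
        then show "p = q" using eq by simp
      qed
      then show ?thesis by (simp add: card_image card_cartesian_product)
    qed
    also have "card ((#) [] ` ?T As (Suc n)) = card (?T As (Suc n))"
      by (rule card_image) simp
    finally show ?thesis by (simp add: tuple_count_def)
  qed
  have "egf_poly_exp (tuple_count (tuples As))" using Cons by simp
  then have "egf_poly_exp (\<lambda>n. tuple_count (tuples As) (Suc n))" by (rule egf_poly_exp_Suc)
  then show ?case using rec by (rule egf_poly_exp_recurrence)
qed

text \<open>
  A word containing the letter \<open>a\<close> splits uniquely at the first occurrence of \<open>a\<close>; the prefix
  is a word over the smaller alphabet \<open>A - {a}\<close>, and the remainder avoids a shorter word.
\<close>

lemma subseq_set_subset: "subseq xs ys \<Longrightarrow> set xs \<subseteq> set ys"
  by (auto elim: list_emb_set)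

text \<open>The last assumption is what the Noetherian induction supplies: results for tuples in
  which the slot \<open>A\<close> is traded for k slots with one letter fewer. Each letter a of w
  inserts a slot \<open>A - {a}\<close> in front of \<open>A\<close>, so \<open>As\<close> varies in
  the induction on w, and k makes room for the inserted slots.\<close>

lemma egf_poly_exp_avoiding_slot:
  fixes D :: "'a list list set"
  assumes "finite A" "set w \<subseteq> A" "\<forall>A \<in> set As \<union> set Bs. finite A"
    and "downclosed D" "D \<subseteq> tuples (As @ A # Bs)"
    and "\<And>us. us \<in> D \<Longrightarrow> \<not> subseq w (us ! length As)"
    and "\<And>Cs (E :: 'a list list set) k. \<forall>A \<in> set Cs. finite A \<Longrightarrow>
      mset (map card Cs) = mset (map card (As @ Bs)) + replicate_mset k (card A - 1) \<Longrightarrow>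
      downclosed E \<Longrightarrow> E \<subseteq> tuples Cs \<Longrightarrow> egf_poly_exp (tuple_count E)"
  shows "egf_poly_exp (tuple_count D)"
  using assms
proof (induction w arbitrary: As D)
  case Nil
  then have "D = {}" by auto
  then show ?case by (simp add: egf_poly_exp_empty)
next
  case (Cons a w)
  note fin = Cons.prems(1,3) and down = Cons.prems(4) and sub = Cons.prems(5)
    and avoid = Cons.prems(6) and IH = Cons.prems(7)
  have a: "a \<in> A" using Cons.prems by simp
  let ?k = "length As"
  \<comment> \<open>Either a is missing in the slot, which shrinks its alphabet, or the slot is cut
    at its first a: \<open>D2\<close> records the two pieces as neighbouring slots and forgets that
    a.\<close>
  define D1 where "D1 = {us \<in> D. a \<notin> set (us ! ?k)}"
  define D2 where
    "D2 = {us @ v # v' # us' |us v v' us'. us @ (v @ a # v') # us' \<in> D \<and> length us = ?k \<and> a \<notin> set v}"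
  have D_form: "\<exists>ws v ws'. us = ws @ v # ws' \<and> length ws = ?k \<and> ws \<in> tuples As \<and> set v \<subseteq> A \<and> ws' \<in> tuples Bs"
    if "us \<in> D" for us
  proof -
    have "list_all2 (\<lambda>A u. set u \<subseteq> A) (As @ A # Bs) us"
      using that sub by (auto simp: tuples_def)
    then obtain ws v ws' where "us = ws @ v # ws'" "length ws = ?k"
      "list_all2 (\<lambda>A u. set u \<subseteq> A) As ws" "set v \<subseteq> A" "list_all2 (\<lambda>A u. set u \<subseteq> A) Bs ws'"
      by (auto simp: list_all2_append1 list_all2_Cons1)
    then show ?thesis unfolding tuples_def by blast
  qed
  have "egf_poly_exp (tuple_count D1)"
  proof (rule IH[where k = 1 and Cs = "As @ (A - {a}) # Bs"])
    show "\<forall>C \<in> set (As @ (A - {a}) # Bs). finite C" using fin by auto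
    show "mset (map card (As @ (A - {a}) # Bs)) =
        mset (map card (As @ Bs)) + replicate_mset 1 (card A - 1)"
      using a fin by simp
    show "downclosed D1"
      unfolding downclosed_def
    proof (intro ballI allI impI)
      fix us vs assume us: "us \<in> D1" and vs: "list_all2 subseq vs us"
      have "?k < length us" using us sub tuples_length unfolding D1_def by fastforce
      then have "subseq (vs ! ?k) (us ! ?k)" using vs by (simp add: list_all2_conv_all_nth)
      then have "set (vs ! ?k) \<subseteq> set (us ! ?k)" by (rule subseq_set_subset)
      then show "vs \<in> D1" using us vs down unfolding D1_def downclosed_def by blast
    qed
    show "D1 \<subseteq> tuples (As @ (A - {a}) # Bs)"
    proof
      fix us assume us: "us \<in> D1"
      then obtain ws v ws' where ws: "us = ws @ v # ws'" "length ws = ?k"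
        "ws \<in> tuples As" "set v \<subseteq> A" "ws' \<in> tuples Bs"
        using D_form unfolding D1_def by blast
      moreover have "a \<notin> set v" using us ws(1,2) by (simp add: D1_def nth_append)
      ultimately show "us \<in> tuples (As @ (A - {a}) # Bs)"
        unfolding tuples_def ws(1) by (auto intro!: list_all2_appendI)
    qed
  qed
  \<comment> \<open>The second piece avoids the shorter word w: together with the forgotten a, an
    occurrence of w in it would give one of \<open>a # w\<close> in the original slot.\<close>
  moreover have "egf_poly_exp (tuple_count D2)"
  proof (rule Cons.IH[of "As @ [A - {a}]"])
    show "downclosed D2"
      unfolding downclosed_def
    proof (intro ballI allI impI)
      fix us vs assume "us \<in> D2" and vs: "list_all2 subseq vs us"
      then obtain ws v v' ws' where us: "us = ws @ v # v' # ws'" "ws @ (v @ a # v') # ws' \<in> D"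
        "length ws = ?k" "a \<notin> set v" by (auto simp: D2_def)
      obtain xs x x' xs' where x: "vs = xs @ x # x' # xs'" "list_all2 subseq xs ws"
        "subseq x v" "subseq x' v'" "list_all2 subseq xs' ws'"
        using vs by (auto simp: us list_all2_append2 list_all2_Cons2)
      have "list_all2 subseq (xs @ (x @ a # x') # xs') (ws @ (v @ a # v') # ws')"
        using x by (auto intro!: list_all2_appendI list_emb_append_mono)
      then have "xs @ (x @ a # x') # xs' \<in> D" using us down unfolding downclosed_def by blast
      moreover have "a \<notin> set x" using us(4) subseq_set_subset[OF x(3)] by blast
      ultimately show "vs \<in> D2"
        using x(1) us(3) list_all2_lengthD[OF x(2)] unfolding D2_def by auto
    qed
    show "D2 \<subseteq> tuples ((As @ [A - {a}]) @ A # Bs)"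
    proof
      fix us assume "us \<in> D2"
      then obtain ws v v' ws' where us: "us = ws @ v # v' # ws'" "ws @ (v @ a # v') # ws' \<in> D"
        "length ws = ?k" "a \<notin> set v" by (auto simp: D2_def)
      have "ws @ (v @ a # v') # ws' \<in> tuples (As @ A # Bs)" using us(2) sub by blast
      then show "us \<in> tuples ((As @ [A - {a}]) @ A # Bs)"
        using us(3,4) by (auto simp: us(1) tuples_def list_all2_append)
    qed
    show "\<not> subseq w (us ! length (As @ [A - {a}]))" if us_D2: "us \<in> D2" for us
    proof -
      obtain ws v v' ws' where us: "us = ws @ v # v' # ws'" "ws @ (v @ a # v') # ws' \<in> D"
        "length ws = ?k" "a \<notin> set v" using us_D2 by (auto simp: D2_def)
      have "\<not> subseq (a # w) (v @ a # v')" using avoid[OF us(2)] us(3) by (metis nth_append_length)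
      moreover have "subseq (a # w) (v @ a # v')" if "subseq w v'"
        using that by (intro subseq_drop_many) simp
      ultimately show ?thesis using us(1,3) by (auto simp: nth_append)
    qed
    show "egf_poly_exp (tuple_count E)"
      if "\<forall>C \<in> set Cs. finite C" "mset (map card Cs) =
        mset (map card ((As @ [A - {a}]) @ Bs)) + replicate_mset k (card A - 1)"
        "downclosed E" "E \<subseteq> tuples Cs" for Cs k and E :: "'a list list set"
      using IH[of Cs "Suc k"] that a fin by simp
  qed (use Cons.prems in auto)
  \<comment> \<open>The forgotten a accounts for one unit of length, hence the shift by 1.\<close>
  moreover have "tuple_count D n = tuple_count D1 n + (if n < 1 then 0 else tuple_count D2 (n - 1))" for n
  proof -
    let ?D2' = "{us \<in> D. a \<in> set (us ! ?k)}"
    let ?f = "\<lambda>us. take ?k us @ (us ! ?k @ a # us ! Suc ?k) # drop (Suc (Suc ?k)) us"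
    have f: "?f (us @ v # v' # us') = us @ (v @ a # v') # us'" if "length us = ?k" for us v v' us'
      using that by (simp add: nth_append flip: that)
    have img: "{us \<in> ?D2'. total_length us = n} = ?f ` {us \<in> D2. Suc (total_length us) = n}"
    proof (intro equalityI subsetI)
      fix us assume us: "us \<in> {us \<in> ?D2'. total_length us = n}"
      then obtain ws v ws' where ws: "us = ws @ v # ws'" "length ws = ?k" using D_form by blast
      with us have "a \<in> set v" by (auto simp: nth_append)
      then obtain y y' where y: "v = y @ a # y'" "a \<notin> set y" by (meson split_list_first)
      have "ws @ y # y' # ws' \<in> {us \<in> D2. Suc (total_length us) = n}"
        using us ws y unfolding D2_def by auto
      moreover have "us = ?f (ws @ y # y' # ws')" using f ws y by simp
      ultimately show "us \<in> ?f ` {us \<in> D2. Suc (total_length us) = n}" by blast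
    next
      fix us assume "us \<in> ?f ` {us \<in> D2. Suc (total_length us) = n}"
      then show "us \<in> {us \<in> ?D2'. total_length us = n}"
        by (auto simp: D2_def f simp del: take_append drop_append) (auto simp: nth_append)
    qed
    have inj: "inj_on ?f {us \<in> D2. Suc (total_length us) = n}"
    proof (rule inj_onI)
      fix us vs assume "us \<in> {us \<in> D2. Suc (total_length us) = n}"
        "vs \<in> {us \<in> D2. Suc (total_length us) = n}" and eq: "?f us = ?f vs"
      then obtain ws v v' ws' xs x x' xs' where us: "us = ws @ v # v' # ws'" "length ws = ?k" "a \<notin> set v"
        and vs: "vs = xs @ x # x' # xs'" "length xs = ?k" "a \<notin> set x"
        by (auto simp: D2_def)
      have "ws @ (v @ a # v') # ws' = xs @ (x @ a # x') # xs'"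
        using eq unfolding us(1) vs(1) f[OF us(2)] f[OF vs(2)] .
      then have eqs: "ws = xs" "v @ a # v' = x @ a # x'" "ws' = xs'" using us(2) vs(2) by auto
      \<comment> \<open>The cut can be recovered: the first piece is everything before the first
        a.\<close>
      have "takeWhile (\<lambda>b. b \<noteq> a) (u @ a # u') = u" if "a \<notin> set u" for u u'
        using that by (induction u) auto
      then have "v = x" using eqs(2) us(3) vs(3) by metis
      then show "us = vs" using eqs us(1) vs(1) by simp
    qed
    have fin': "\<forall>C \<in> set (As @ A # Bs). finite C" using fin by auto
    have "{us \<in> D. total_length us = n} =
        {us \<in> D1. total_length us = n} \<union> {us \<in> ?D2'. total_length us = n}"
      by (auto simp: D1_def)
    moreover have "finite {us \<in> D1. total_length us = n}" "finite {us \<in> ?D2'. total_length us = n}"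
      by (rule finite_tuples_subset[OF fin']; use sub in \<open>auto simp: D1_def\<close>)+
    moreover have "{us \<in> D1. total_length us = n} \<inter> {us \<in> ?D2'. total_length us = n} = {}"
      by (auto simp: D1_def)
    ultimately have "card {us \<in> D. total_length us = n} =
        card {us \<in> D1. total_length us = n} + card {us \<in> ?D2'. total_length us = n}"
      by (simp add: card_Un_disjoint)
    also have "card {us \<in> ?D2'. total_length us = n} = card {us \<in> D2. Suc (total_length us) = n}"
      unfolding img by (rule card_image[OF inj])
    also have "\<dots> = (if n < 1 then 0 else card {us \<in> D2. total_length us = n - 1})"
      by (cases n) auto
    finally show ?thesis by (simp add: tuple_count_def)
  qed
  ultimately show ?case
    using egf_poly_exp_add[OF _ egf_poly_exp_shift[where m = 1]] by presburger
qed

text \<open>The descent behind the Noetherian induction: cutting a word lengthens the tuple, but the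
  new alphabets are smaller than the one they replace.\<close>

lemma mset_replace_less:
  fixes c :: nat
  assumes "0 < c"
  shows "X + replicate_mset k (c - 1) < add_mset c X"
proof -
  have "replicate_mset k (c - 1) < {#c#}"
    using assms by (intro ex_gt_imp_less_multiset) (auto simp: in_replicate_mset)
  then show ?thesis by (simp add: add.commute flip: add_mset_add_single)
qed

text \<open>
  Noetherian induction on the multiset of alphabet sizes, without Higman's lemma: unless \<open>D\<close>
  contains all tuples, it avoids some tuple \<open>w\<close>, and then \<open>D\<close> is covered by its subsets in which
  a fixed slot avoids the corresponding entry of \<open>w\<close>.
\<close>

theorem egf_poly_exp_downclosed:
  assumes "\<forall>A \<in> set As. finite A" "downclosed D" "D \<subseteq> tuples As"
  shows "egf_poly_exp (tuple_count D)"
  using assms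
proof (induction "mset (map card As)" arbitrary: As D rule: less_induct)
  case less
  note fin = less.prems(1)
  have slot: "egf_poly_exp (tuple_count E)"
    if E: "downclosed E" "E \<subseteq> tuples As" and i: "i < length As"
      and w: "w \<noteq> []" "set w \<subseteq> As ! i" and av: "\<And>us. us \<in> E \<Longrightarrow> \<not> subseq w (us ! i)" for E i w
  proof (rule egf_poly_exp_avoiding_slot[where As = "take i As" and A = "As ! i" and Bs = "drop (Suc i) As" and w = w])
    have split: "As = take i As @ As ! i # drop (Suc i) As" using i by (rule id_take_nth_drop)
    show "finite (As ! i)" using i fin by simp
    show "\<forall>A \<in> set (take i As) \<union> set (drop (Suc i) As). finite A"
      using fin by (auto dest: in_set_takeD in_set_dropD)
    show "E \<subseteq> tuples (take i As @ As ! i # drop (Suc i) As)" using E split by simp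
    show "\<not> subseq w (us ! length (take i As))" if "us \<in> E" for us using av[OF that] i by simp
    show "egf_poly_exp (tuple_count E')"
      if "\<forall>A \<in> set Cs. finite A" "mset (map card Cs) =
        mset (map card (take i As @ drop (Suc i) As)) + replicate_mset k (card (As ! i) - 1)"
        "downclosed E'" "E' \<subseteq> tuples Cs" for Cs k and E' :: "'a list list set"
    proof (rule less.hyps[OF _ that(1,3,4)])
      \<comment> \<open>A nonempty w shows that the slot has a letter, so its alphabet really can
        shrink.\<close>
      have "As ! i \<noteq> {}" using w by (cases w) auto
      then have "0 < card (As ! i)" using \<open>finite (As ! i)\<close> by (simp add: card_gt_0_iff)
      then have "mset (map card Cs) < add_mset (card (As ! i)) (mset (map card (take i As @ drop (Suc i) As)))"
        unfolding that(2) by (rule mset_replace_less)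
      also have "\<dots> = mset (map card As)" by (subst (3) split) simp
      finally show "mset (map card Cs) < mset (map card As)" .
    qed
  qed (use E w in auto)
  have avoiding: "egf_poly_exp (tuple_count E)"
    if "downclosed E" "E \<subseteq> tuples As" "w \<in> tuples As" "\<And>us. us \<in> E \<Longrightarrow> \<not> list_all2 subseq w us" for E w
    using that
  proof (induction "length (filter (\<lambda>v. v \<noteq> []) w)" arbitrary: w E rule: less_induct)
    case (less w E)
    note E = less.prems(1,2) and w = less.prems(3) and av = less.prems(4)
    have len: "length w = length As" using w by (rule tuples_length)
    show ?case
    proof (cases "\<forall>v \<in> set w. v = []")
      case True
      have "list_all2 subseq w us" if "us \<in> E" for us
      proof -
        have "us \<in> tuples As" using that E(2) by blast
        then have "length w = length us" using len tuples_length by metis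
        moreover have "subseq (w ! i) (us ! i)" if "i < length w" for i
          using True nth_mem[OF that] by force
        ultimately show ?thesis by (rule list_all2_all_nthI)
      qed
      then have "E = {}" using av by blast
      then show ?thesis by (simp add: egf_poly_exp_empty)
    next
      case False
      then obtain i where i: "i < length As" "w ! i \<noteq> []" using len by (metis in_set_conv_nth)
      have wi: "set (w ! i) \<subseteq> As ! i" using w i by (auto simp: tuples_def list_all2_conv_all_nth)
      \<comment> \<open>A tuple not above w either is not above w with entry i blanked out, which
        has fewer nonempty entries, or avoids \<open>w ! i\<close> in slot i. The overlap of the two
        cases also avoids \<open>w ! i\<close> there, so inclusion and exclusion settle the
        count.\<close>
      define E1 where "E1 = {us \<in> E. \<not> list_all2 subseq (w[i := []]) us}"
      define E2 where "E2 = {us \<in> E. \<not> subseq (w ! i) (us ! i)}"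
      have "E = E1 \<union> E2"
      proof -
        have "list_all2 subseq w us"
          if "list_all2 subseq (w[i := []]) us" "subseq (w ! i) (us ! i)" for us
          using that unfolding list_all2_conv_all_nth by (metis length_list_update nth_list_update_neq)
        then show ?thesis using av unfolding E1_def E2_def by blast
      qed
      moreover have sub: "E1 \<subseteq> tuples As" "E2 \<subseteq> tuples As" using E by (auto simp: E1_def E2_def)
      moreover have d1: "downclosed E1"
        unfolding downclosed_def
      proof (intro ballI allI impI)
        fix us vs assume us: "us \<in> E1" and vs: "list_all2 subseq vs us"
        have "list_all2 subseq (w[i := []]) us" if "list_all2 subseq (w[i := []]) vs"
          by (rule list_all2_trans[OF _ that vs]) (rule subseq_order.order_trans)
        then show "vs \<in> E1" using us vs E(1) unfolding E1_def downclosed_def by blast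
      qed
      have d2: "downclosed E2"
        unfolding downclosed_def
      proof (intro ballI allI impI)
        fix us vs assume us: "us \<in> E2" and vs: "list_all2 subseq vs us"
        have "length us = length As" using us sub by (blast intro: tuples_length)
        then have "subseq (vs ! i) (us ! i)" using vs i by (auto simp: list_all2_conv_all_nth)
        then show "vs \<in> E2"
          using us vs E(1) unfolding E2_def downclosed_def
          by (blast intro: subseq_order.order_trans)
      qed
      have "egf_poly_exp (tuple_count E1)"
      proof (rule less.hyps[OF _ d1 sub(1)])
        show "length (filter (\<lambda>v. v \<noteq> []) (w[i := []])) < length (filter (\<lambda>v. v \<noteq> []) w)"
        proof -
          have "w = take i w @ w ! i # drop (Suc i) w"
            using i len by (intro id_take_nth_drop) simp
          then have "length (filter (\<lambda>v. v \<noteq> []) w) =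
              length (filter (\<lambda>v. v \<noteq> []) (take i w @ w ! i # drop (Suc i) w))" by simp
          then show ?thesis using i len by (simp add: upd_conv_take_nth_drop)
        qed
        show "w[i := []] \<in> tuples As"
          using w i by (auto simp: tuples_def list_all2_conv_all_nth nth_list_update)
      qed (auto simp: E1_def)
      moreover have "egf_poly_exp (tuple_count E2)"
        by (rule slot[OF d2 sub(2) i(1,2) wi]) (simp add: E2_def)
      moreover have "egf_poly_exp (tuple_count (E1 \<inter> E2))"
        by (rule slot[OF downclosed_Int[OF d1 d2] _ i(1,2) wi]) (use sub in \<open>auto simp: E2_def\<close>)
      ultimately show ?thesis
        using tuple_count_Un[OF fin sub] egf_poly_exp_add egf_poly_exp_diff by presburger
    qed
  qed
  show ?case
  proof (cases "D = tuples As")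
    case True
    then show ?thesis using tuple_count_tuples[OF fin] by simp
  next
    case False
    then obtain w where "w \<in> tuples As" "w \<notin> D" using less.prems by blast
    \<comment> \<open>A downward closed set that misses w contains nothing above w.\<close>
    then show ?thesis using avoiding[of D w] less.prems unfolding downclosed_def by blast
  qed
qed

section \<open>Words with stars and standard monomials\<close>

primrec word_letters :: "('a + 'b) list \<Rightarrow> 'a list" where
  "word_letters [] = []"
| "word_letters (x # u) = (case x of Inl c \<Rightarrow> [c] | Inr s \<Rightarrow> []) @ word_letters u"

primrec word_stars :: "('a + 'b) list \<Rightarrow> 'b list" where
  "word_stars [] = []"
| "word_stars (x # u) = (case x of Inl c \<Rightarrow> [] | Inr s \<Rightarrow> [s]) @ word_stars u"

text \<open>The entries fill the gaps before, between and after the stars, so the tuple is meant to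
  have one entry more than there are stars; on such tuples the map is injective.\<close>

primrec join :: "'b list \<Rightarrow> 'a list list \<Rightarrow> ('a + 'b) list" where
  "join [] us = map Inl (hd us)"
| "join (s # ss) us = map Inl (hd us) @ Inr s # join ss (tl us)"

lemma word_stars_append [simp]: "word_stars (u @ v) = word_stars u @ word_stars v"
  by (induction u) auto

lemma word_stars_map [simp]: "word_stars (map Inl w) = []" "word_stars (map Inr ss) = ss"
  by (induction w) (auto, induction ss, auto)

lemma word_stars_join [simp]: "word_stars (join ss us) = ss"
  by (induction ss arbitrary: us) auto

lemma length_join:
  "length us = Suc (length ss) \<Longrightarrow> length (join ss us) = length ss + total_length us"
  by (induction ss arbitrary: us) (auto simp: length_Suc_conv)

lemma takeWhile_isl: "takeWhile isl (map Inl w @ Inr s # u) = map Inl w"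
  by (induction w) auto

lemma join_inj:
  fixes us vs :: "'a list list" and ss :: "'b list"
  shows
  "length us = Suc (length ss) \<Longrightarrow> length vs = Suc (length ss) \<Longrightarrow> join ss us = join ss vs \<Longrightarrow> us = vs"
proof (induction ss arbitrary: us vs)
  case Nil
  then show ?case by (auto simp: length_Suc_conv inj_map_eq_map)
next
  case (Cons s ss)
  obtain u us' v vs' where us: "us = u # us'" "vs = v # vs'"
    using Cons.prems by (auto simp: length_Suc_conv)
  have eq: "map Inl u @ Inr s # join ss us' = map Inl v @ Inr s # join ss vs'"
    using Cons.prems us by simp
  \<comment> \<open>The first star bounds the first entry, so that entry can be read off.\<close>
  then have "(map Inl u :: ('a + 'b) list) = map Inl v" using takeWhile_isl by metis
  moreover from this have "join ss us' = join ss vs'" using eq by simp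
  ultimately show ?case using Cons.IH[of us' vs'] Cons.prems us by (simp add: inj_map_eq_map)
qed

lemma join_surj: "\<exists>us. length us = Suc (length (word_stars u)) \<and> join (word_stars u) us = u"
proof (induction u)
  case Nil
  show ?case by (rule exI[of _ "[[]]"]) simp
next
  case (Cons x u)
  then obtain us where us: "length us = Suc (length (word_stars u))" "join (word_stars u) us = u"
    by blast
  show ?case
  proof (cases x)
    case (Inl c)
    have "join (word_stars u) ((c # hd us) # tl us) = Inl c # join (word_stars u) us"
      by (cases "word_stars u") auto
    then show ?thesis using us Inl by (intro exI[of _ "(c # hd us) # tl us"]) auto
  next
    case (Inr s)
    then show ?thesis using us by (intro exI[of _ "[] # us"]) auto
  qed
qed

definition deletion_closed :: "('a + 'b) list set \<Rightarrow> bool" where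
  "deletion_closed S \<longleftrightarrow> (\<forall>p c q. p @ Inl c # q \<in> S \<longrightarrow> p @ q \<in> S)"

lemma deletion_closedD: "deletion_closed S \<Longrightarrow> p @ Inl c # q \<in> S \<Longrightarrow> p @ q \<in> S"
  by (auto simp: deletion_closed_def)

text \<open>The prefix p absorbs the letters that are kept, so it varies in the induction.\<close>

lemma delete_subseq:
  assumes del: "deletion_closed S"
  shows "subseq w v \<Longrightarrow> p @ map Inl v @ q \<in> S \<Longrightarrow> p @ map Inl w @ q \<in> S"
proof (induction arbitrary: p rule: list_emb.induct)
  case (list_emb_Nil ys)
  then show ?case
  proof (induction ys)
    case (Cons y ys)
    then show ?case using deletion_closedD[OF del, of p y "map Inl ys @ q"] by simp
  qed simp
next
  case (list_emb_Cons xs ys y)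
  then show ?case using deletion_closedD[OF del, of p y "map Inl ys @ q"] by simp
next
  case (list_emb_Cons2 x y xs ys)
  then show ?case using list_emb_Cons2.IH[of "p @ [Inl y]"] by simp
qed

lemma delete_join:
  assumes del: "deletion_closed S"
  shows "list_all2 subseq vs us \<Longrightarrow> length us = Suc (length ss) \<Longrightarrow>
    p @ join ss us \<in> S \<Longrightarrow> p @ join ss vs \<in> S"
proof (induction ss arbitrary: us vs p)
  case Nil
  then show ?case using delete_subseq[OF del, where q = "[]"]
    by (auto simp: length_Suc_conv list_all2_Cons2)
next
  case (Cons s ss)
  obtain u us' v vs' where us: "us = u # us'" "vs = v # vs'" "subseq v u" "list_all2 subseq vs' us'"
    using Cons.prems by (auto simp: length_Suc_conv list_all2_Cons2)
  have "p @ map Inl v @ (Inr s # join ss us') \<in> S"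
    using delete_subseq[OF del us(3), of p "Inr s # join ss us'"] Cons.prems us by simp
  then show ?case
    using Cons.IH[OF us(4), of "p @ map Inl v @ [Inr s]"] Cons.prems us by simp
qed

lemma egf_poly_exp_deletion_closed_stars:
  fixes S :: "('a::finite + 'b) list set"
  assumes del: "deletion_closed S"
  shows "egf_poly_exp (\<lambda>n. of_nat (card {u \<in> S. length u = n \<and> word_stars u = ss}))"
proof -
  let ?As = "replicate (Suc (length ss)) (UNIV :: 'a set)"
  define D where "D = {us \<in> tuples ?As. join ss us \<in> S}"
  have len: "length us = Suc (length ss)" if "us \<in> D" for us
    using that tuples_length[of us ?As] by (simp add: D_def)
  have DI: "us \<in> D" if "length us = Suc (length ss)" "join ss us \<in> S" for us
    using that by (simp add: D_def tuples_def list_all2_conv_all_nth del: replicate_Suc)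
  have "downclosed D"
    unfolding downclosed_def
  proof (intro ballI allI impI)
    fix us vs assume us: "us \<in> D" and vs: "list_all2 subseq vs us"
    have "join ss vs \<in> S"
      using delete_join[OF del vs len[OF us], of "[]"] us by (simp add: D_def)
    then show "vs \<in> D" using DI len[OF us] list_all2_lengthD[OF vs] by simp
  qed
  then have "egf_poly_exp (tuple_count D)"
    by (intro egf_poly_exp_downclosed[of ?As]) (auto simp: D_def)
  \<comment> \<open>The stars contribute to the length of a word but not to
    \<open>total_length\<close>, hence the shift by their number.\<close>
  then have "egf_poly_exp (\<lambda>n. if n < length ss then 0 else tuple_count D (n - length ss))"
    by (rule egf_poly_exp_shift)
  moreover have "of_nat (card {u \<in> S. length u = n \<and> word_stars u = ss}) =
      (if n < length ss then 0 else tuple_count D (n - length ss))" for n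
  proof -
    have "{u \<in> S. length u = n \<and> word_stars u = ss} =
        join ss ` {us \<in> D. length ss + total_length us = n}"
    proof (intro equalityI subsetI)
      fix u assume u: "u \<in> {u \<in> S. length u = n \<and> word_stars u = ss}"
      then obtain us where us: "length us = Suc (length ss)" "join ss us = u"
        using join_surj[of u] by blast
      then have "us \<in> {us \<in> D. length ss + total_length us = n}"
        using u DI[of us] length_join[of us ss] by simp
      then show "u \<in> join ss ` {us \<in> D. length ss + total_length us = n}" using us(2) by blast
    next
      fix u assume "u \<in> join ss ` {us \<in> D. length ss + total_length us = n}"
      then show "u \<in> {u \<in> S. length u = n \<and> word_stars u = ss}"
        using len length_join by (auto simp: D_def)
    qed
    moreover have "inj_on (join ss) {us \<in> D. length ss + total_length us = n}"
      using len join_inj by (blast intro: inj_onI)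
    ultimately have "card {u \<in> S. length u = n \<and> word_stars u = ss} =
        card {us \<in> D. length ss + total_length us = n}"
      by (simp add: card_image)
    moreover have "{us \<in> D. length ss + total_length us = n} =
        (if n < length ss then {} else {us \<in> D. total_length us = n - length ss})" by auto
    ultimately show ?thesis by (simp add: tuple_count_def)
  qed
  ultimately show ?thesis by simp
qed

lemma egf_poly_exp_deletion_closed:
  fixes S :: "('a::finite + 'b) list set"
  assumes "deletion_closed S" and fin: "finite (word_stars ` S)"
    and finS: "\<And>n. finite {u \<in> S. length u = n}"
  shows "egf_poly_exp (\<lambda>n. of_nat (card {u \<in> S. length u = n}))"
proof -
  have "of_nat (card {u \<in> S. length u = n}) =
      (\<Sum>ss\<in>word_stars ` S. of_nat (card {u \<in> S. length u = n \<and> word_stars u = ss}) :: rat)" for n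
  proof -
    have "{u \<in> S. length u = n} = (\<Union>ss\<in>word_stars ` S. {u \<in> S. length u = n \<and> word_stars u = ss})"
      by auto
    moreover have "card (\<Union>ss\<in>word_stars ` S. {u \<in> S. length u = n \<and> word_stars u = ss}) =
        (\<Sum>ss\<in>word_stars ` S. card {u \<in> S. length u = n \<and> word_stars u = ss})"
    proof (rule card_UN_disjoint[OF fin])
      show "\<forall>ss\<in>word_stars ` S. finite {u \<in> S. length u = n \<and> word_stars u = ss}"
        using finite_subset[OF _ finS[of n]] by (metis (no_types, lifting) Collect_mono)
    qed blast
    ultimately show ?thesis by simp
  qed
  then show ?thesis
    by (simp add: egf_poly_exp_sum egf_poly_exp_deletion_closed_stars[OF assms(1)])
qed

section \<open>Spans and dimensions along a linear order\<close>

context vector_space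
begin

text \<open>Linearity is demanded on the subspace A alone, because the permutation maps of a module
  satisfy their axioms on a single graded piece.\<close>

lemma map_span_subset:
  assumes "subspace A" and add: "\<And>x y. x \<in> A \<Longrightarrow> y \<in> A \<Longrightarrow> T (x + y) = T x + T y"
    and scale: "\<And>c x. x \<in> A \<Longrightarrow> T (scale c x) = scale c (T x)"
    and S: "S \<subseteq> A" "\<And>s. s \<in> S \<Longrightarrow> T s \<in> span R" and x: "x \<in> span S"
  shows "T x \<in> span R"
proof -
  have "T 0 = 0" using scale[of 0 0] subspace_0[OF assms(1)] by simp
  then have "subspace {x \<in> A. T x \<in> span R}"
    using assms(1) span_zero span_add span_scale
    by (intro subspaceI) (simp_all add: add scale subspace_0 subspace_add subspace_scale)
  moreover have "S \<subseteq> {x \<in> A. T x \<in> span R}" using S by auto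
  ultimately show ?thesis using span_minimal x by blast
qed

text \<open>Going through the indices in increasing order, an element is kept exactly if it lies
  outside the span of all earlier ones. The kept elements so far always span the same space as all
  elements so far, so they end up as a basis.\<close>

lemma dim_span_irreducible:
  fixes \<kappa> :: "'i \<Rightarrow> 'o::linorder"
  assumes "finite I" "inj_on \<kappa> I"
  shows "dim (span (e ` I)) = card {i \<in> I. e i \<notin> span (e ` {j \<in> I. \<kappa> j < \<kappa> i})}"
proof -
  define B where "B I = {i \<in> I. e i \<notin> span (e ` {j \<in> I. \<kappa> j < \<kappa> i})}" for I
  have "independent (e ` B I) \<and> inj_on e (B I) \<and> span (e ` B I) = span (e ` I)"
    using assms
  proof (induction I rule: finite_ranking_induct[where f = \<kappa>])
    case empty
    then show ?case by (simp add: B_def independent_empty)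
  next
    case (insert x S)
    then have IH: "independent (e ` B S)" "inj_on e (B S)" "span (e ` B S) = span (e ` S)"
      by (auto simp: inj_on_insert)
    show ?case
    proof (cases "x \<in> S")
      case True
      then have "insert x S = S" by blast
      then show ?thesis using IH by simp
    next
      case False
      have less: "\<kappa> y < \<kappa> x" if "y \<in> S" for y
        using insert that False by (metis inj_on_eq_iff insertI1 insertI2 order_le_less)
      have "x \<notin> B S" using False by (simp add: B_def)
      \<comment> \<open>The new index has the largest key: it sees all of S below it and changes
        nothing below the old indices.\<close>
      have lower: "{j \<in> insert x S. \<kappa> j < \<kappa> x} = S" using less by auto
      have lower': "{j \<in> insert x S. \<kappa> j < \<kappa> i} = {j \<in> S. \<kappa> j < \<kappa> i}" if "i \<in> S" for i
        using less[OF that] by auto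
      have "i \<in> B (insert x S) \<longleftrightarrow> (if i = x then e x \<notin> span (e ` S) else i \<in> B S)" for i
        unfolding B_def using False lower lower'[of i] by (cases "i = x"; cases "i \<in> S") simp_all
      then have B: "B (insert x S) = (if e x \<in> span (e ` S) then B S else insert x (B S))"
        using \<open>x \<notin> B S\<close> by (metis insert_iff set_eqI)
      show ?thesis
      proof (cases "e x \<in> span (e ` S)")
        case True
        then have "span (e ` insert x S) = span (e ` S)" by (simp add: span_redundant)
        then show ?thesis using IH True unfolding B by simp
      next
        case irr: False
        then have x: "e x \<notin> span (e ` B S)" using IH(3) by simp
        then have x': "e x \<notin> e ` B S" using span_base by blast
        have "span (insert (e x) (e ` B S)) = span (insert (e x) (e ` S))"
          using IH(3) by (simp only: span_insert)
        moreover have "independent (insert (e x) (e ` B S))"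
          using IH(1) x by (rule independent_insertI[rotated])
        moreover have "inj_on e (insert x (B S))" using IH(2) x' by (auto simp: inj_on_insert)
        ultimately show ?thesis using irr unfolding B by simp
      qed
    qed
  qed
  then have "dim (span (e ` I)) = card (B I)" by (metis card_image dim_span dim_eq_card_independent)
  then show ?thesis by (simp add: B_def)
qed

end

text \<open>Words of equal length are compared at their first difference, and the two letters there
  stay opposite each other after the insertion.\<close>

lemma insert_at_less:
  fixes xs ys :: "'a::linorder list"
  assumes "length xs = length ys" "xs < ys"
  shows "take k xs @ c # drop k xs < take k ys @ c # drop k ys"
  using assms
proof (induction k arbitrary: xs ys)
  case (Suc k)
  then show ?case by (cases xs; cases ys) auto
qed simp

section \<open>The star words of a module\<close>

text \<open>The action of \<open>word_perm\<close> on bare lists, over an arbitrary alphabet so that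
  it also applies to words with stars.\<close>

definition act :: "(nat \<Rightarrow> nat) \<Rightarrow> 'a list \<Rightarrow> 'a list" where
  "act \<sigma> xs = permute_list (inv \<sigma>) xs"

lemma length_act [simp]: "length (act \<sigma> xs) = length xs"
  by (simp add: act_def)

lemma mset_act: "\<sigma> permutes {..<length xs} \<Longrightarrow> mset (act \<sigma> xs) = mset xs"
  by (simp add: act_def permutes_inv)

lemma act_id [simp]: "act id xs = xs"
  by (simp add: act_def inv_id)

lemma act_comp:
  assumes "\<sigma> permutes {..<length xs}" "\<tau> permutes {..<length xs}"
  shows "act (\<sigma> \<circ> \<tau>) xs = act \<sigma> (act \<tau> xs)"
proof -
  have "inv (\<sigma> \<circ> \<tau>) = inv \<tau> \<circ> inv \<sigma>"
    using assms by (intro o_inv_distrib) (auto dest: permutes_bij)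
  then show ?thesis
    unfolding act_def using permute_list_compose[OF permutes_inv[OF assms(1)]] by simp
qed

lemma act_inv:
  assumes "\<sigma> permutes {..<length xs}"
  shows "act (inv \<sigma>) (act \<sigma> xs) = xs"
  using act_comp[OF permutes_inv[OF assms] assms] permutes_inv_o(2)[OF assms] by simp

lemma act_nth:
  assumes "\<sigma> permutes {..<length xs}" "i < length xs"
  shows "act \<sigma> xs ! \<sigma> i = xs ! i"
proof -
  have "\<sigma> i < length xs" using assms permutes_in_image by fastforce
  then show ?thesis
    using assms by (simp add: act_def permute_list_nth permutes_inv permutes_inverses(2))
qed

lemma act_eqI:
  assumes "\<sigma> permutes {..<length xs}" "length ys = length xs"
    and "\<And>i. i < length xs \<Longrightarrow> ys ! \<sigma> i = xs ! i"
  shows "act \<sigma> xs = ys"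
proof (rule nth_equalityI)
  fix j assume "j < length (act \<sigma> xs)"
  then have j: "j < length xs" by simp
  have "inv \<sigma> j < length xs" using permutes_in_image[OF permutes_inv[OF assms(1)], of j] j by simp
  then show "act \<sigma> xs ! j = ys ! j"
    using assms(3)[of "inv \<sigma> j"] act_nth[OF assms(1), of "inv \<sigma> j"]
    by (simp add: permutes_inverses(1)[OF assms(1)])
qed (simp add: assms)

lemma act_exists:
  assumes "mset xs = mset ys"
  obtains \<sigma> where "\<sigma> permutes {..<length xs}" "act \<sigma> xs = ys"
proof -
  obtain p where p: "p permutes {..<length xs}" "permute_list p xs = ys"
    using mset_eq_permutation[of ys xs] assms by metis
  show ?thesis
    by (rule that[of "inv p"]) (use p in \<open>simp_all add: permutes_inv act_def permutes_inv_inv\<close>)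
qed

lemma act_map:
  assumes "\<sigma> permutes {..<length xs}"
  shows "act \<sigma> (map f xs) = map f (act \<sigma> xs)"
  unfolding act_def by (rule permute_list_map) (use assms in \<open>simp add: permutes_inv\<close>)

text \<open>One permutation, depending on k and n alone, serves all words. It is found on the list
  of positions, of which every word of the right length is an image under its indexing map.\<close>

lemma move_head_permutation:
  assumes "k \<le> n"
  obtains \<sigma> where "\<sigma> permutes {..<Suc n}"
    "\<And>(xs :: 'a list) c. length xs = n \<Longrightarrow> act \<sigma> (c # xs) = take k xs @ c # drop k xs"
proof -
  have "mset [0..<Suc n] = mset ([1..<Suc k] @ 0 # [Suc k..<Suc n])"
    using assms by (subst set_eq_iff_mset_eq_distinct[symmetric]) auto
  then obtain \<sigma> where \<sigma>: "\<sigma> permutes {..<Suc n}" "act \<sigma> [0..<Suc n] = [1..<Suc k] @ 0 # [Suc k..<Suc n]"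
    using act_exists[of "[0..<Suc n]"] by (metis diff_zero length_upt)
  have "act \<sigma> (c # xs) = take k xs @ c # drop k xs" if "length xs = n" for xs :: "'a list" and c
  proof -
    let ?g = "\<lambda>i. (c # xs) ! i"
    have "c # xs = map ?g [0..<Suc n]" using that by (metis length_Cons map_nth)
    then have "act \<sigma> (c # xs) = map ?g (act \<sigma> [0..<Suc n])"
      using act_map[of \<sigma> "[0..<Suc n]" ?g] \<sigma>(1) by simp
    also have "\<dots> = map ?g [1..<Suc k] @ c # map ?g [Suc k..<Suc n]" unfolding \<sigma>(2) by simp
    also have "map ?g [1..<Suc k] = take k xs"
      using assms that by (intro nth_equalityI) (auto simp del: upt_Suc)
    also have "map ?g [Suc k..<Suc n] = drop k xs"
      using assms that by (intro nth_equalityI) (auto simp del: upt_Suc)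
    finally show ?thesis .
  qed
  then show ?thesis using that \<sigma>(1) by blast
qed

lemma perm_sum_permutes:
  assumes "\<sigma> permutes {..<n}" "\<tau> permutes {..<m}"
  shows "perm_sum n \<sigma> \<tau> permutes {..<n + m}"
proof -
  have \<sigma>: "\<sigma> i < n \<longleftrightarrow> i < n" "inv \<sigma> i < n \<longleftrightarrow> i < n" for i
    using permutes_in_image[OF assms(1), of i] permutes_in_image[OF permutes_inv[OF assms(1)], of i]
    by simp_all
  have "perm_sum n \<sigma> \<tau> (perm_sum n (inv \<sigma>) (inv \<tau>) i) = i" for i
    using \<sigma> assms by (simp add: perm_sum_def permutes_inverses)
  moreover have "perm_sum n (inv \<sigma>) (inv \<tau>) (perm_sum n \<sigma> \<tau> i) = i" for i
    using \<sigma> assms by (simp add: perm_sum_def permutes_inverses)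
  moreover have "perm_sum n \<sigma> \<tau> i = i" if "i \<notin> {..<n + m}" for i
    using that permutes_not_in[OF assms(2), of "i - n"] by (simp add: perm_sum_def)
  ultimately show ?thesis unfolding permutes_def by metis
qed

lemma act_perm_sum:
  assumes "\<sigma> permutes {..<length xs}" "\<tau> permutes {..<length ys}"
  shows "act (perm_sum (length xs) \<sigma> \<tau>) (xs @ ys) = act \<sigma> xs @ act \<tau> ys"
proof (rule act_eqI)
  show "perm_sum (length xs) \<sigma> \<tau> permutes {..<length (xs @ ys)}"
    using perm_sum_permutes[OF assms] by simp
  fix i assume i: "i < length (xs @ ys)"
  show "(act \<sigma> xs @ act \<tau> ys) ! perm_sum (length xs) \<sigma> \<tau> i = (xs @ ys) ! i"
  proof (cases "i < length xs")
    case True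
    then have "\<sigma> i < length xs" using permutes_in_image[OF assms(1), of i] by simp
    then show ?thesis using True act_nth[OF assms(1)] by (simp add: perm_sum_def nth_append)
  next
    case False
    then show ?thesis using i act_nth[OF assms(2), of "i - length xs"]
      by (simp add: perm_sum_def nth_append)
  qed
qed simp

text \<open>Represents \<open>mon w \<odot> g\<close> for g of degree m; every word with the stars
  0, ..., m - 1 is a permutation of such a base word.\<close>

definition star_base :: "nat \<Rightarrow> 'd list \<Rightarrow> ('d + nat) list" where
  "star_base m w = map Inl w @ map Inr [0..<m]"

definition star_words :: "nat \<Rightarrow> ('d + nat) list set" where
  "star_words m = {u. mset (word_stars u) = mset [0..<m]}"

lemma length_star_base [simp]: "length (star_base m w) = length w + m"
  by (simp add: star_base_def)

lemma mset_word_decomp: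
  "mset u = image_mset Inl (mset (word_letters u)) + image_mset Inr (mset (word_stars u))"
  by (induction u) (auto split: sum.splits)

lemma star_words_cong:
  assumes "mset u = mset v" "u \<in> star_words m"
  shows "v \<in> star_words m"
proof -
  have "image_mset projr (filter_mset (\<lambda>x. \<not> isl x) (mset u)) = mset (word_stars u)" for u :: "('d + nat) list"
    by (induction u) (auto split: sum.splits)
  from this[of u] this[of v] show ?thesis using assms by (simp add: star_words_def)
qed

lemma star_base_mem: "star_base m w \<in> star_words m"
  by (simp add: star_base_def star_words_def)

lemma act_star_base_exists:
  assumes "u \<in> star_words m"
  obtains \<sigma> w where "\<sigma> permutes {..<length w + m}" "act \<sigma> (star_base m w) = u"
    "length w + m = length u"
proof -
  have "mset (star_base m (word_letters u)) = mset u"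
    using assms mset_word_decomp[of u] by (simp add: star_base_def star_words_def)
  then obtain \<sigma> where "\<sigma> permutes {..<length (star_base m (word_letters u))}"
    "act \<sigma> (star_base m (word_letters u)) = u"
    by (rule act_exists)
  then show ?thesis using that by (metis length_act length_star_base)
qed

text \<open>The stars are pairwise distinct and stand at the same places in both words, so the
  permutation fixes every star position and moves only variables. This makes
  \<open>star_elem\<close> well defined.\<close>

lemma star_base_act_eq:
  assumes \<tau>: "\<tau> permutes {..<length w + m}" and eq: "act \<tau> (star_base m w) = star_base m w'"
  obtains \<rho> where "\<rho> permutes {..<length w}" "act \<rho> w = w'" "\<tau> = perm_sum (length w) \<rho> id"
proof -
  let ?l = "length w"
  have len: "length w' = ?l" using arg_cong[OF eq, of length] by simp
  have fix_stars: "\<tau> i = i" if "?l \<le> i" for i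
  proof (cases "i < ?l + m")
    case True
    have "\<tau> i < ?l + m" using permutes_in_image[OF \<tau>, of i] True by simp
    moreover have "star_base m w' ! \<tau> i = Inr (i - ?l)"
      using act_nth[of \<tau> "star_base m w" i] \<tau> eq True that by (simp add: star_base_def nth_append)
    ultimately show ?thesis
      using len that by (cases "\<tau> i < ?l") (auto simp: star_base_def nth_append)
  next
    case False
    then show ?thesis using permutes_not_in[OF \<tau>] by simp
  qed
  have \<rho>: "\<tau> permutes {..<?l}"
    by (rule permutes_superset[OF \<tau>]) (use fix_stars in auto)
  have sum: "\<tau> = perm_sum ?l \<tau> id"
    by (rule ext) (use fix_stars in \<open>auto simp: perm_sum_def\<close>)
  have "act \<tau> (map Inl w @ map Inr [0..<m]) = act \<tau> (map Inl w) @ map Inr [0..<m]"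
    using act_perm_sum[of \<tau> "map Inl w" id "map Inr [0..<m]"] \<rho> sum by (simp add: permutes_id)
  then have "map Inl (act \<tau> w) = (map Inl w' :: ('a + nat) list)"
    using eq \<rho> by (simp add: star_base_def act_map)
  then have "act \<tau> w = w'" by (simp add: inj_map_eq_map)
  then show ?thesis using that \<rho> sum by blast
qed

section \<open>Monomials of the free algebra\<close>

definition mon :: "'d list \<Rightarrow> ('d, 'k::field) tca" where
  "mon w = Poly_Mapping.single (Word w) 1"

lemma mon_Nil: "mon [] = 1"
  by (simp add: mon_def flip: zero_word_def)

lemma mon_append: "mon (v @ w) = mon v * mon w"
  by (simp add: mon_def mult_single plus_word_def)

lemma mon_piece: "mon w \<in> tca_piece (length w)"
  by (simp add: mon_def tca_piece_def)

lemma tca_perm_mon: "tca_perm \<sigma> (mon w) = mon (act \<sigma> w)"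
  by (simp add: tca_perm_def mon_def word_perm_def act_def)

lemma tca_const_mon: "tca_const c * mon w = mon w * tca_const c"
  by (simp add: tca_const_def mon_def mult_single)

lemma tca_eq_sum_mon:
  "a = (\<Sum>w\<in>Poly_Mapping.keys a. tca_const (Poly_Mapping.lookup a w) * mon (letters w))"
proof -
  have "Poly_Mapping.lookup (\<Sum>w\<in>Poly_Mapping.keys a. Poly_Mapping.single w (Poly_Mapping.lookup a w)) v =
      Poly_Mapping.lookup a v" for v
    by (simp add: lookup_sum lookup_single when_def in_keys_iff)
  then have "a = (\<Sum>w\<in>Poly_Mapping.keys a. Poly_Mapping.single w (Poly_Mapping.lookup a w))"
    by (simp add: poly_mapping_eq_iff fun_eq_iff)
  then show ?thesis by (simp add: tca_const_def mon_def mult_single)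
qed

context tca_module
begin

lemma amult_zero_left: "0 \<odot> x = 0"
  using amult_add_left[of 0 0 x] by simp

lemma amult_sum_left: "(\<Sum>i\<in>I. a i) \<odot> x = (\<Sum>i\<in>I. a i \<odot> x)"
  by (induction I rule: infinite_finite_induct) (simp_all add: amult_zero_left amult_add_left)

lemma mon_kscale: "mon w \<odot> kscale c x = kscale c (mon w \<odot> x)"
  by (simp add: kscale_def amult_assoc tca_const_mon)

lemma kscale_piece: "x \<in> M n \<Longrightarrow> kscale c x \<in> M n"
  using piece_amult[of "tca_const c" 0 x n]
  by (simp add: kscale_def tca_piece_def tca_const_def zero_word_def)

lemma subspace_piece: "k.subspace (M n)"
  by (intro k.subspaceI piece_zero piece_add kscale_piece)

lemma mon_amult_piece: "x \<in> M m \<Longrightarrow> mon w \<odot> x \<in> M (length w + m)"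
  by (rule piece_amult[OF mon_piece])

section \<open>Homogeneous components\<close>

definition component :: "'m \<Rightarrow> nat \<Rightarrow> 'm" where
  "component x = (THE f. graded_family M f \<and> family_sum f = x)"

lemma component: "graded_family M (component x)" "family_sum (component x) = x"
  using theI'[OF direct_sum[of x]] by (simp_all add: component_def)

lemma component_eqI: "graded_family M f \<Longrightarrow> family_sum f = x \<Longrightarrow> component x = f"
  using direct_sum[of x] component[of x] by blast

lemma component_homogeneous:
  assumes "x \<in> M n"
  shows "component x = (\<lambda>i. if i = n then x else 0)"
proof (rule component_eqI)
  let ?f = "\<lambda>i. if i = n then x else 0"
  have sub: "{i. ?f i \<noteq> 0} \<subseteq> {n}" by auto
  then show "graded_family M ?f"
    using assms piece_zero finite_subset by (auto simp: graded_family_def)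
  have "family_sum ?f = (\<Sum>i\<in>{n}. ?f i)"
    unfolding family_sum_def by (rule sum.mono_neutral_left) (use sub in auto)
  then show "family_sum ?f = x" by simp
qed

lemma component_add: "component (x + y) = (\<lambda>n. component x n + component y n)"
proof (rule component_eqI)
  let ?f = "component x" and ?g = "component y"
  let ?I = "{n. ?f n \<noteq> 0} \<union> {n. ?g n \<noteq> 0}"
  have fin: "finite ?I" using component(1) by (simp add: graded_family_def)
  have sub: "{n. ?f n + ?g n \<noteq> 0} \<subseteq> ?I" by auto
  show "graded_family M (\<lambda>n. ?f n + ?g n)"
    using component(1)[of x] component(1)[of y] piece_add finite_subset[OF sub fin]
    by (auto simp: graded_family_def)
  have "family_sum (\<lambda>n. ?f n + ?g n) = (\<Sum>n\<in>?I. ?f n + ?g n)"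
    unfolding family_sum_def by (rule sum.mono_neutral_left[OF fin sub]) auto
  also have "\<dots> = (\<Sum>n\<in>?I. ?f n) + (\<Sum>n\<in>?I. ?g n)" by (rule sum.distrib)
  also have "(\<Sum>n\<in>?I. ?f n) = family_sum ?f"
    unfolding family_sum_def by (rule sum.mono_neutral_right[OF fin]) auto
  also have "(\<Sum>n\<in>?I. ?g n) = family_sum ?g"
    unfolding family_sum_def by (rule sum.mono_neutral_right[OF fin]) auto
  finally show "family_sum (\<lambda>n. ?f n + ?g n) = x + y" by (simp add: component(2))
qed

lemma component_kscale: "component (kscale c x) = (\<lambda>n. kscale c (component x n))"
proof (rule component_eqI)
  let ?f = "component x"
  let ?I = "{n. ?f n \<noteq> 0}"
  have fin: "finite ?I" using component(1) by (simp add: graded_family_def)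
  have sub: "{n. kscale c (?f n) \<noteq> 0} \<subseteq> ?I" by auto
  show "graded_family M (\<lambda>n. kscale c (?f n))"
    using component(1)[of x] kscale_piece finite_subset[OF sub fin]
    by (auto simp: graded_family_def)
  have "family_sum (\<lambda>n. kscale c (?f n)) = (\<Sum>n\<in>?I. kscale c (?f n))"
    unfolding family_sum_def by (rule sum.mono_neutral_left[OF fin sub]) auto
  also have "\<dots> = kscale c (family_sum ?f)"
    by (simp add: family_sum_def k.scale_sum_right)
  finally show "family_sum (\<lambda>n. kscale c (?f n)) = kscale c x" by (simp add: component(2))
qed

text \<open>
  In a word \<open>u\<close> with stars \<open>0, \<dots>, m - 1\<close>, the letters stand for the variables and the stars for
  the \<open>m\<close> positions occupied by the generator \<open>g\<close> of degree \<open>m\<close>.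
\<close>

definition star_elem :: "nat \<Rightarrow> 'm \<Rightarrow> ('d + nat) list \<Rightarrow> 'm" where
  "star_elem m g u = (SOME x. \<exists>\<sigma> w. \<sigma> permutes {..<length w + m} \<and> act \<sigma> (star_base m w) = u \<and>
     x = perm (length w + m) \<sigma> (mon w \<odot> g))"

text \<open>Independence of the choice: two representations of u differ by a permutation between
  base words. By \<open>star_base_act_eq\<close> it moves only variables, and equivariance with the
  identity on the positions of g turns w into w'.\<close>

lemma star_elem_eq:
  assumes g: "g \<in> M m" and \<sigma>: "\<sigma> permutes {..<length w + m}" and u: "act \<sigma> (star_base m w) = u"
  shows "star_elem m g u = perm (length w + m) \<sigma> (mon w \<odot> g)"
proof -
  have "x = perm (length w + m) \<sigma> (mon w \<odot> g)"
    if \<sigma>': "\<sigma>' permutes {..<length w' + m}" and u': "act \<sigma>' (star_base m w') = u"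
      and x: "x = perm (length w' + m) \<sigma>' (mon w' \<odot> g)" for x \<sigma>' w'
  proof -
    have len: "length w' = length w"
      using arg_cong[OF u, of length] arg_cong[OF u', of length] by simp
    note \<sigma>' = \<sigma>'[unfolded len]
    define \<tau> where "\<tau> = inv \<sigma>' \<circ> \<sigma>"
    have \<tau>: "\<tau> permutes {..<length w + m}"
      unfolding \<tau>_def using \<sigma> \<sigma>' by (intro permutes_compose permutes_inv)
    have "act \<tau> (star_base m w) = act (inv \<sigma>') (act \<sigma> (star_base m w))"
      unfolding \<tau>_def using \<sigma> \<sigma>' by (intro act_comp) (simp_all add: permutes_inv)
    also have "\<dots> = star_base m w'"
      unfolding u u'[symmetric] using \<sigma>' len by (intro act_inv) simp
    finally have "act \<tau> (star_base m w) = star_base m w'" .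
    then obtain \<rho> where \<rho>: "\<rho> permutes {..<length w}" "act \<rho> w = w'" "\<tau> = perm_sum (length w) \<rho> id"
      by (rule star_base_act_eq[OF \<tau>])
    have "perm (length w + m) \<tau> (mon w \<odot> g) = mon w' \<odot> g"
      using equivariant[OF \<rho>(1) permutes_id mon_piece g] \<rho> perm_id[OF g] by (simp add: tca_perm_mon)
    moreover have "\<sigma> = \<sigma>' \<circ> \<tau>"
      unfolding \<tau>_def using permutes_inv_o(1)[OF \<sigma>'] by (simp flip: o_assoc add: o_assoc)
    ultimately show ?thesis
      using perm_comp[OF \<sigma>' \<tau> mon_amult_piece[OF g]] x len by simp
  qed
  then show ?thesis unfolding star_elem_def using \<sigma> u by (intro some_equality) blast+
qed

lemma star_elem_act:
  assumes g: "g \<in> M m" and u: "u \<in> star_words m" and \<rho>: "\<rho> permutes {..<length u}"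
  shows "star_elem m g (act \<rho> u) = perm (length u) \<rho> (star_elem m g u)"
proof -
  obtain \<sigma> w where \<sigma>: "\<sigma> permutes {..<length w + m}" "act \<sigma> (star_base m w) = u" "length w + m = length u"
    using u by (rule act_star_base_exists)
  have "act (\<rho> \<circ> \<sigma>) (star_base m w) = act \<rho> u"
    using act_comp[of \<rho> "star_base m w" \<sigma>] \<sigma> \<rho> by simp
  moreover have "\<rho> \<circ> \<sigma> permutes {..<length w + m}"
    using \<sigma> \<rho> by (intro permutes_compose) simp_all
  ultimately have "star_elem m g (act \<rho> u) = perm (length w + m) (\<rho> \<circ> \<sigma>) (mon w \<odot> g)"
    by (intro star_elem_eq[OF g])
  also have "\<dots> = perm (length w + m) \<rho> (perm (length w + m) \<sigma> (mon w \<odot> g))"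
    using \<sigma> \<rho> by (intro perm_comp mon_amult_piece g) simp_all
  also have "perm (length w + m) \<sigma> (mon w \<odot> g) = star_elem m g u"
    using star_elem_eq[OF g \<sigma>(1,2)] by simp
  finally show ?thesis using \<sigma>(3) by simp
qed

text \<open>The longer word is reached by the same permutation moved one place to the right, which
  is the standard embedding with the identity on the new first position; equivariance then pulls
  \<open>mon [c]\<close> out.\<close>

lemma star_elem_Cons:
  assumes g: "g \<in> M m" and u: "u \<in> star_words m"
  shows "star_elem m g (Inl c # u) = mon [c] \<odot> star_elem m g u"
proof -
  obtain \<sigma> w where \<sigma>: "\<sigma> permutes {..<length w + m}" "act \<sigma> (star_base m w) = u" "length w + m = length u"
    using u by (rule act_star_base_exists)
  let ?\<tau> = "perm_sum 1 id \<sigma>"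
  have "act ?\<tau> (star_base m (c # w)) = Inl c # u"
    using act_perm_sum[of id "[Inl c]" \<sigma> "star_base m w"] \<sigma> by (simp add: star_base_def permutes_id)
  moreover have \<tau>: "?\<tau> permutes {..<length (c # w) + m}"
    using perm_sum_permutes[OF permutes_id \<sigma>(1), of 1] by simp
  ultimately have "star_elem m g (Inl c # u) = perm (length (c # w) + m) ?\<tau> (mon (c # w) \<odot> g)"
    by (intro star_elem_eq[OF g])
  also have "mon (c # w) \<odot> g = mon [c] \<odot> mon w \<odot> g"
  proof -
    have "mon (c # w) = (mon [c] * mon w :: ('d, 'k) tca)" using mon_append[of "[c]" w] by simp
    then show ?thesis by (simp add: amult_assoc)
  qed
  also have "perm (length (c # w) + m) ?\<tau> (mon [c] \<odot> mon w \<odot> g) =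
      mon [c] \<odot> perm (length w + m) \<sigma> (mon w \<odot> g)"
    using equivariant[OF permutes_id \<sigma>(1) mon_piece[of "[c]"] mon_amult_piece[OF g]]
    by (simp add: tca_perm_mon)
  also have "perm (length w + m) \<sigma> (mon w \<odot> g) = star_elem m g u"
    using star_elem_eq[OF g \<sigma>(1,2)] by simp
  finally show ?thesis .
qed

lemma star_elem_base:
  assumes g: "g \<in> M m"
  shows "star_elem m g (star_base m []) = g"
proof -
  have "star_elem m g (star_base m []) = perm (length ([] :: 'd list) + m) id (mon [] \<odot> g)"
    by (rule star_elem_eq[OF g]) (auto intro: permutes_id)
  then show ?thesis using perm_id[OF g] by (simp add: mon_Nil amult_one)
qed

lemma star_elem_piece:
  assumes g: "g \<in> M m" and u: "u \<in> star_words m"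
  shows "star_elem m g u \<in> M (length u)"
proof -
  obtain \<sigma> w where \<sigma>: "\<sigma> permutes {..<length w + m}" "act \<sigma> (star_base m w) = u" "length w + m = length u"
    using u by (rule act_star_base_exists)
  then show ?thesis
    using star_elem_eq[OF g \<sigma>(1,2)] perm_closed[OF \<sigma>(1) mon_amult_piece[OF g]] by simp
qed


text \<open>The permutation is chosen before m, g and u, so inserting c at place k is the same
  linear map for all generators and all words of length n.\<close>

lemma star_elem_insert:
  assumes "k \<le> n"
  obtains \<sigma> where "\<sigma> permutes {..<Suc n}"
    "\<And>m g u. g \<in> M m \<Longrightarrow> u \<in> star_words m \<Longrightarrow> length u = n \<Longrightarrow>
      star_elem m g (take k u @ Inl c # drop k u) = perm (Suc n) \<sigma> (mon [c] \<odot> star_elem m g u)"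
proof -
  obtain \<sigma> where \<sigma>: "\<sigma> permutes {..<Suc n}"
    "\<And>(xs :: ('d + nat) list) c. length xs = n \<Longrightarrow> act \<sigma> (c # xs) = take k xs @ c # drop k xs"
    using move_head_permutation[OF assms] by blast
  have "star_elem m g (take k u @ Inl c # drop k u) = perm (Suc n) \<sigma> (mon [c] \<odot> star_elem m g u)"
    if "g \<in> M m" "u \<in> star_words m" "length u = n" for m g u
  proof -
    have "Inl c # u \<in> star_words m" using that(2) by (simp add: star_words_def)
    then show ?thesis
      using that star_elem_act[OF that(1), of "Inl c # u" \<sigma>] \<sigma> star_elem_Cons by simp
  qed
  then show ?thesis using that \<sigma>(1) by blast
qed

lemma perm_kscale:
  "\<sigma> permutes {..<n} \<Longrightarrow> x \<in> M n \<Longrightarrow> perm n \<sigma> (kscale c x) = kscale c (perm n \<sigma> x)"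
  by (simp add: kscale_def perm_scale)

end

section \<open>Standard monomials of a finitely generated module\<close>

locale graded_generators = tca_module amult M perm
  for amult :: "('d::finite, 'k::field) tca \<Rightarrow> 'm::ab_group_add \<Rightarrow> 'm"  (infixr \<open>\<odot>\<close> 75)
    and M :: "nat \<Rightarrow> 'm set"
    and perm :: "nat \<Rightarrow> (nat \<Rightarrow> nat) \<Rightarrow> 'm \<Rightarrow> 'm" +
  fixes G :: "'m set" and dg :: "'m \<Rightarrow> nat" and idx :: "'m \<Rightarrow> nat"
  assumes finite_G: "finite G" and dg: "g \<in> G \<Longrightarrow> g \<in> M (dg g)" and idx: "inj_on idx G"
    and generated: "\<Inter>{N. graded_submodule N \<and> perm_stable N \<and> G \<subseteq> N} = UNIV"
begin

definition monomials :: "nat \<Rightarrow> ('m \<times> ('d + nat) list) set" where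
  "monomials n = {(g, u). g \<in> G \<and> u \<in> star_words (dg g) \<and> length u = n}"

definition elem :: "'m \<times> ('d + nat) list \<Rightarrow> 'm" where
  "elem gu = star_elem (dg (fst gu)) (fst gu) (snd gu)"

text \<open>Orders the monomials of each degree totally: \<open>idx\<close> numbers the generators
  and \<open>to_nat\<close> the variables and stars, both arbitrarily; pairs and lists are compared
  lexicographically.\<close>

definition key :: "'m \<times> ('d + nat) list \<Rightarrow> nat \<times> nat list" where
  "key gu = (idx (fst gu), map to_nat (snd gu))"

definition lower :: "'m \<times> ('d + nat) list \<Rightarrow> ('m \<times> ('d + nat) list) set" where
  "lower gu = {hv \<in> monomials (length (snd gu)). key hv < key gu}"

definition standard :: "'m \<Rightarrow> ('d + nat) list set" where
  "standard g = {u \<in> star_words (dg g). elem (g, u) \<notin> k.span (elem ` lower (g, u))}"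

lemma elem_piece: "gu \<in> monomials n \<Longrightarrow> elem gu \<in> M n"
  using star_elem_piece dg by (auto simp: monomials_def elem_def)

lemma span_elem_subset: "k.span (elem ` monomials n) \<subseteq> M n"
  by (intro k.span_minimal subspace_piece) (auto intro: elem_piece)

text \<open>The span over all degrees is a graded submodule, stable under permutations, and contains
  G, hence is everything. As its spanning elements are homogeneous, those of degree n span degree
  n.\<close>

lemma span_elem: "k.span (elem ` monomials n) = M n"
proof
  show "M n \<subseteq> k.span (elem ` monomials n)"
  proof
    let ?E = "\<Union>n. elem ` monomials n"
    let ?N = "k.span ?E"
    \<comment> \<open>Projecting to degree n keeps the spanning elements of degree n and sends the
      others to 0 or, if they are 0 already, changes nothing.\<close>
    have comp: "component x n \<in> k.span (elem ` monomials n)" if "x \<in> ?N" for x n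
    proof -
      have "k.subspace {x. component x n \<in> k.span (elem ` monomials n)}"
      proof (intro k.subspaceI CollectI)
        show "component 0 n \<in> k.span (elem ` monomials n)"
          using component_homogeneous[OF piece_zero, of n] by (simp add: k.span_zero)
      qed (auto simp: component_add component_kscale k.span_add k.span_scale)
      moreover have "?E \<subseteq> {x. component x n \<in> k.span (elem ` monomials n)}"
        using component_homogeneous[OF elem_piece] by (auto simp: k.span_base k.span_zero)
      ultimately show ?thesis using k.span_minimal that by blast
    qed
    have mono: "k.span (elem ` monomials n) \<subseteq> ?N" for n by (intro k.span_mono) auto
    \<comment> \<open>Single variables suffice, since together with the scalars they generate the
      algebra.\<close>
    have mon_letter: "mon [c] \<odot> x \<in> ?N" if "x \<in> ?N" for c x
    proof (rule k.map_span_subset[OF k.subspace_UNIV _ _ _ _ that])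
      fix s assume "s \<in> ?E"
      then obtain g u where gu: "g \<in> G" "u \<in> star_words (dg g)" "s = elem (g, u)"
        by (auto simp: monomials_def)
      then have "mon [c] \<odot> s = elem (g, Inl c # u)"
        using star_elem_Cons[OF dg[OF gu(1)] gu(2)] by (simp add: elem_def)
      moreover have "(g, Inl c # u) \<in> monomials (Suc (length u))"
        using gu by (simp add: monomials_def star_words_def)
      ultimately show "mon [c] \<odot> s \<in> ?N" by (metis UN_I UNIV_I imageI k.span_base)
    qed (auto simp: amult_add_right mon_kscale)
    have mon_word: "mon w \<odot> x \<in> ?N" if "x \<in> ?N" for w x
    proof (induction w)
      case Nil
      then show ?case using that by (simp add: mon_Nil amult_one)
    next
      case (Cons c w)
      have "mon (c # w) = (mon [c] * mon w :: ('d, 'k) tca)" using mon_append[of "[c]" w] by simp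
      then show ?case using mon_letter[OF Cons] by (simp add: amult_assoc)
    qed
    have "a \<odot> x \<in> ?N" if "x \<in> ?N" for a x
    proof -
      have "a \<odot> x = (\<Sum>w\<in>Poly_Mapping.keys a. kscale (Poly_Mapping.lookup a w) (mon (letters w) \<odot> x))"
        by (subst tca_eq_sum_mon[of a]) (simp add: amult_sum_left kscale_def amult_assoc)
      also have "\<dots> \<in> ?N" by (intro k.span_sum k.span_scale mon_word that)
      finally show ?thesis .
    qed
    moreover have "f n \<in> ?N" if "graded_family M f" "family_sum f \<in> ?N" for f n
      using comp[OF that(2), of n] component_eqI[OF that(1) refl] mono by auto
    ultimately have "graded_submodule ?N"
      unfolding graded_submodule_def by (simp add: k.span_zero k.span_add)
    moreover have "perm_stable ?N"
      unfolding perm_stable_def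
    proof (intro allI impI ballI)
      fix n \<sigma> x assume \<sigma>: "\<sigma> permutes {..<n}" and x: "x \<in> ?N \<inter> M n"
      \<comment> \<open>\<open>perm n \<sigma>\<close> is known to be linear on \<open>M n\<close>
        only, so x is first written in elements of degree n.\<close>
      have "x \<in> k.span (elem ` monomials n)"
        using x comp[of x n] component_homogeneous[of x n] by simp
      then show "perm n \<sigma> x \<in> ?N"
      proof (rule k.map_span_subset[OF subspace_piece, rotated 4])
        fix s assume "s \<in> elem ` monomials n"
        then obtain g u where gu: "g \<in> G" "u \<in> star_words (dg g)" "length u = n" "s = elem (g, u)"
          by (auto simp: monomials_def)
        then have "perm n \<sigma> s = elem (g, act \<sigma> u)"
          using star_elem_act[OF dg[OF gu(1)] gu(2)] \<sigma> by (simp add: elem_def)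
        moreover have "(g, act \<sigma> u) \<in> monomials n"
          using gu star_words_cong[OF mset_act[symmetric] gu(2)] \<sigma> by (simp add: monomials_def)
        ultimately show "perm n \<sigma> s \<in> ?N" by (metis UN_I UNIV_I imageI k.span_base)
      qed (use \<sigma> elem_piece in \<open>auto simp: perm_add perm_kscale\<close>)
    qed
    moreover have "G \<subseteq> ?N"
    proof
      fix g assume g: "g \<in> G"
      have "g = elem (g, star_base (dg g) [])" using star_elem_base[OF dg[OF g]] by (simp add: elem_def)
      moreover have "(g, star_base (dg g) []) \<in> monomials (dg g)"
        using g star_base_mem by (simp add: monomials_def)
      ultimately show "g \<in> ?N" by (metis UN_I UNIV_I imageI k.span_base)
    qed
    ultimately have "?N = UNIV" using generated by blast
    fix x assume "x \<in> M n"
    then show "x \<in> k.span (elem ` monomials n)"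
      using comp[of x n] component_homogeneous[of x n] \<open>?N = UNIV\<close> by simp
  qed
qed (rule span_elem_subset)

lemma key_insert_less:
  assumes "key (h, v) < key (g, u)" "length v = length u"
  shows "key (h, take k v @ x # drop k v) < key (g, take k u @ x # drop k u)"
  using assms insert_at_less[of "map to_nat v" "map to_nat u" k "to_nat x"]
  by (auto simp: key_def take_map drop_map)

text \<open>Contrapositive: inserting c at a fixed place carries a relation that expresses the
  element of \<open>p @ q\<close> by smaller ones to such a relation for
  \<open>p @ Inl c # q\<close>, because insertion is linear on the piece, maps monomials to
  monomials and preserves their order.\<close>

lemma deletion_closed_standard:
  assumes g: "g \<in> G"
  shows "deletion_closed (standard g)"
  unfolding deletion_closed_def
proof (intro allI impI)
  fix p q :: "('d + nat) list" and c
  assume st: "p @ Inl c # q \<in> standard g"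
  let ?n = "length (p @ q)" and ?k = "length p"
  let ?ins = "\<lambda>u. take ?k u @ Inl c # drop ?k u"
  have pq: "p @ q \<in> star_words (dg g)"
    using st by (simp add: standard_def star_words_def)
  have ins_words: "?ins u \<in> star_words m" if "u \<in> star_words m" for u m
    using that word_stars_append[of "take ?k u" "drop ?k u"] by (simp add: star_words_def)
  obtain \<sigma> where \<sigma>: "\<sigma> permutes {..<Suc ?n}"
    "\<And>m g u. g \<in> M m \<Longrightarrow> u \<in> star_words m \<Longrightarrow> length u = ?n \<Longrightarrow>
      star_elem m g (?ins u) = perm (Suc ?n) \<sigma> (mon [c] \<odot> star_elem m g u)"
    using star_elem_insert[of ?k ?n] by auto
  let ?T = "\<lambda>x. perm (Suc ?n) \<sigma> (mon [c] \<odot> x)"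
  have T_elem: "?T (elem (h, v)) = elem (h, ?ins v)" if "(h, v) \<in> monomials ?n" for h v
    using \<sigma>(2)[OF dg] that by (simp add: elem_def monomials_def)
  have piece: "mon [c] \<odot> x \<in> M (Suc ?n)" if "x \<in> M ?n" for x
    using mon_amult_piece[OF that, of "[c]"] by simp
  show "p @ q \<in> standard g"
  proof (rule ccontr)
    assume "p @ q \<notin> standard g"
    then have "elem (g, p @ q) \<in> k.span (elem ` lower (g, p @ q))"
      using pq by (simp add: standard_def)
    then have "?T (elem (g, p @ q)) \<in> k.span (elem ` lower (g, p @ Inl c # q))"
    proof (rule k.map_span_subset[OF subspace_piece[of ?n], rotated 4])
      show "?T (x + y) = ?T x + ?T y" if "x \<in> M ?n" "y \<in> M ?n" for x y
        using that \<sigma>(1) piece by (simp add: amult_add_right perm_add)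
      show "?T (kscale a x) = kscale a (?T x)" if "x \<in> M ?n" for a x
        using that \<sigma>(1) piece by (simp add: mon_kscale perm_kscale)
      show "elem ` lower (g, p @ q) \<subseteq> M ?n" using elem_piece by (auto simp: lower_def)
      fix s assume "s \<in> elem ` lower (g, p @ q)"
      then obtain h v where hv: "(h, v) \<in> monomials ?n" "key (h, v) < key (g, p @ q)" "s = elem (h, v)"
        by (auto simp: lower_def)
      have "key (h, ?ins v) < key (g, ?ins (p @ q))"
        using hv by (intro key_insert_less) (auto simp: monomials_def)
      moreover have "(h, ?ins v) \<in> monomials (Suc ?n)"
        using hv(1) ins_words by (simp add: monomials_def)
      ultimately have "(h, ?ins v) \<in> lower (g, p @ Inl c # q)" by (simp add: lower_def)
      then show "?T s \<in> k.span (elem ` lower (g, p @ Inl c # q))"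
        unfolding hv(3) T_elem[OF hv(1)] by (intro k.span_base imageI)
    qed
    moreover have "?T (elem (g, p @ q)) = elem (g, p @ Inl c # q)"
      using T_elem[of g "p @ q"] g pq by (simp add: monomials_def)
    ultimately show False using st by (simp add: standard_def)
  qed
qed

lemma star_order:
  assumes "mset ss = mset [0..<m]"
  shows "set ss = {..<m}" "length ss = m"
  using mset_eq_setD[OF assms] mset_eq_length[OF assms] by (simp_all add: atLeast0LessThan)

lemma finite_star_words: "finite {u \<in> star_words m :: ('d + nat) list set. length u = n}"
proof -
  have "set u \<subseteq> range Inl \<union> Inr ` {..<m}" if "u \<in> star_words m" for u :: "('d + nat) list"
  proof -
    have "set (word_stars u) = {..<m}" using that star_order by (auto simp: star_words_def simp del: mset_upt)
    moreover have "set u = Inl ` set (word_letters u) \<union> Inr ` set (word_stars u)"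
      using arg_cong[OF mset_word_decomp[of u], of set_mset] by simp
    ultimately show ?thesis by auto
  qed
  then have "{u \<in> star_words m :: ('d + nat) list set. length u = n} \<subseteq>
      {u. set u \<subseteq> range Inl \<union> Inr ` {..<m} \<and> length u = n}" by auto
  then show ?thesis by (rule finite_subset) (intro finite_lists_length_eq, simp)
qed

lemma dim_piece: "k.dim (M n) = (\<Sum>g\<in>G. card {u \<in> standard g. length u = n})"
proof -
  have mon_eq: "monomials n = (SIGMA g:G. {u \<in> star_words (dg g). length u = n})"
    by (auto simp: monomials_def)
  \<comment> \<open>Only finitely many variables and stars are available, so \<open>M n\<close> has
    a finite spanning set and \<open>k.dim\<close> is its true dimension.\<close>
  have fin: "finite (monomials n)"
    unfolding mon_eq using finite_G finite_star_words by blast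
  have inj: "inj_on key (monomials n)"
  proof (rule inj_onI)
    fix x y assume "x \<in> monomials n" "y \<in> monomials n" "key x = key y"
    then show "x = y"
      using inj_onD[OF idx] by (cases x; cases y) (auto simp: monomials_def key_def inj_map_eq_map)
  qed
  have "k.dim (M n) =
      card {gu \<in> monomials n. elem gu \<notin> k.span (elem ` {hv \<in> monomials n. key hv < key gu})}"
    using k.dim_span_irreducible[OF fin inj, of elem] by (simp add: span_elem)
  also have "{gu \<in> monomials n. elem gu \<notin> k.span (elem ` {hv \<in> monomials n. key hv < key gu})} =
      (SIGMA g:G. {u \<in> standard g. length u = n})"
    by (auto simp: monomials_def standard_def lower_def)
  also have "card \<dots> = (\<Sum>g\<in>G. card {u \<in> standard g. length u = n})"
  proof (intro card_SigmaI finite_G ballI)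
    show "finite {u \<in> standard g. length u = n}" for g
      by (rule finite_subset[OF _ finite_star_words[of "dg g" n]]) (auto simp: standard_def)
  qed
  finally show ?thesis .
qed

lemma exp_hilbert_series_mem: "exp_hilbert_series \<in> poly_t_exp_t"
proof -
  have "egf_poly_exp (\<lambda>n. of_nat (card {u \<in> standard g. length u = n}))" if g: "g \<in> G" for g
  proof (rule egf_poly_exp_deletion_closed[OF deletion_closed_standard[OF g]])
    \<comment> \<open>Each star occurs exactly once, so only finitely many orders of the stars
      arise.\<close>
    have "{ss. mset ss = mset [0..<dg g]} \<subseteq> {ss. set ss \<subseteq> {..<dg g} \<and> length ss = dg g}"
      by (auto simp: star_order simp del: mset_upt)
    then have "finite {ss. mset ss = mset [0..<dg g]}"
      by (rule finite_subset) (intro finite_lists_length_eq, simp)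
    then show "finite (word_stars ` standard g)"
      by (rule finite_subset[rotated]) (auto simp: standard_def star_words_def)
    show "finite {u \<in> standard g. length u = n}" for n
      by (rule finite_subset[OF _ finite_star_words[of "dg g" n]]) (auto simp: standard_def)
  qed
  then have "egf_poly_exp (\<lambda>n. \<Sum>g\<in>G. of_nat (card {u \<in> standard g. length u = n}))"
    by (rule egf_poly_exp_sum)
  then show ?thesis
    by (simp add: egf_poly_exp_def exp_hilbert_series_def dim_piece)
qed

end

theorem corollary7p2p9:
  fixes amult :: "('d::finite, 'k::field) tca \<Rightarrow> 'm::ab_group_add \<Rightarrow> 'm"
    and M :: "nat \<Rightarrow> 'm set"
    and perm :: "nat \<Rightarrow> (nat \<Rightarrow> nat) \<Rightarrow> 'm \<Rightarrow> 'm"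
  assumes "tca_module amult M perm"
    and "tca_module.finitely_generated amult M perm"
  shows "tca_module.exp_hilbert_series amult M \<in> poly_t_exp_t"
proof -
  interpret tca_module amult M perm by (rule assms(1))
  obtain G where G: "finite G" "G \<subseteq> (\<Union>n. M n)"
    "\<Inter>{N. graded_submodule N \<and> perm_stable N \<and> G \<subseteq> N} = UNIV"
    using assms(2) unfolding finitely_generated_def by blast
  obtain idx :: "'m \<Rightarrow> nat" where idx: "inj_on idx G"
    using finite_imp_inj_to_nat_seg[OF G(1)] by blast
  \<comment> \<open>A degree is chosen for each generator; a zero generator may receive any
    degree.\<close>
  have "\<forall>g\<in>G. \<exists>n. g \<in> M n" using G(2) by blast
  then obtain dg where dg: "\<And>g. g \<in> G \<Longrightarrow> g \<in> M (dg g)" by metis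
  interpret graded_generators amult M perm G dg idx
    by unfold_locales (use G idx dg in auto)
  show ?thesis by (rule exp_hilbert_series_mem)
qed

end
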